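(* Let $0<\alpha<\frac12$ and let $h$ be a real function contracting on $[0,1]$ such that $\mathrm{Supp}(h)=[a,b]\subset\,]0,1[$. Then the equation $$(-\Delta)^{\alpha}_{]0,1[}(g)=h$$ has only one solution $g$ locally contracting on $]0,1[$ (hence in $C^0(]0,1[)$) with $g(0)=g(1)=0$. This solution is defined by: 1. for $x\in]0,1[$, $g(x)=\int_0^1G_\alpha(x,y)h(y)\,dy$, with $$G_\alpha(x,y)=\frac{1}{\Gamma^2(\alpha)}x^\alpha y^\alpha\int_{\max(x,y)}^1\frac{(t-x)^{\alpha-1}(t-y)^{\alpha-1}}{t^{2\alpha}}\,dt\quad\text{for }0<x\ne y<1,$$ and $G_\alpha(0,0)=0$; 2. $g(z)=0$ for $z\le0$ or $z\ge1$.
   Context: $]a,b[$ denotes the open interval. A function $f$ is contracting on an interval $I$ if $|f(x)-f(y)|\le|x-y|$ for all $x,y\in I$. A function $\psi$ is locally contracting on $]a,b[$ if it belongs to $C^{0,1}(]a,b[)$, i.e. for every interval $[c,d]\subset]a,b[$ with $d-c$ sufficiently small there is $K_{[c,d]}>0$ with $|\psi(x)-\psi(x')|\le K_{[c,d]}|x-x'|$ for all $x,x'\in[c,d]$. Fractional Laplacian on $]0,1[$: for a function $g$ defined on $]0,1[$ and $x\in]0,1[$, $$\big((-\Delta)^{\alpha}_{]0,1[}(g)\big)(x)=C_1(\alpha)\left(\mathrm{PV}\int_0^1\frac{g(x)-g(y)}{|x-y|^{1+2\alpha}}\,dy+\frac{g(x)}{2\alpha}\big(x^{-2\alpha}+(1-x)^{-2\alpha}\big)\right)$$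 whenever this exists, with PV the principal value and $C_1(\alpha)=\frac{2^{2\alpha}\Gamma(\frac{1+2\alpha}{2})}{\sqrt\pi\,|\Gamma(-\alpha)|}$. The equation is required to hold at every point of $]0,1[$.
   Formalization: The condition g(0)=g(1)=0 is read as: g is continuous on [0,1] and vanishes at 0 and 1. With mere pointwise values at 0 and 1 uniqueness fails, since multiples of (x(1-x))^(α-1) on ]0,1[ solve the homogeneous equation. *)

theory Defs
  imports "HOL-Analysis.Analysis"
begin

definition locally_contracting_on :: "real \<Rightarrow> real \<Rightarrow> (real \<Rightarrow> real) \<Rightarrow> bool" where
  "locally_contracting_on a b \<psi> \<longleftrightarrow>
     (\<exists>\<delta>>0. \<forall>c d. c \<le> d \<and> d - c < \<delta> \<and> {c..d} \<subseteq> {a<..<b} \<longrightarrow>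
        (\<exists>K>0. K-lipschitz_on {c..d} \<psi>))"

text \<open>The cut-off integrals are required to converge absolutely, so that the limit is never
  taken over the default value 0 of a divergent integral.\<close>
definition has_principal_value :: "(real \<Rightarrow> real) \<Rightarrow> real \<Rightarrow> real set \<Rightarrow> real \<Rightarrow> bool" where
  "has_principal_value f x S I \<longleftrightarrow>
     (\<forall>\<epsilon>>0. set_integrable lborel {y \<in> S. \<epsilon> \<le> \<bar>x - y\<bar>} f) \<and>
     ((\<lambda>\<epsilon>. LINT y : {y \<in> S. \<epsilon> \<le> \<bar>x - y\<bar>} | lborel. f y) \<longlongrightarrow> I) (at_right 0)"

definition frac_lap_const :: "real \<Rightarrow> real" where
  "frac_lap_const \<alpha> =
     2 powr (2 * \<alpha>) * Gamma ((1 + 2 * \<alpha>) / 2) / (sqrt pi * \<bar>Gamma (- \<alpha>)\<bar>)"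

text \<open>A relation rather than a function: it says that the fractional Laplacian of \<open>g\<close> on
  \<open>]0,1[\<close> exists at \<open>x\<close> and has the value \<open>v\<close>.\<close>
definition has_frac_laplacian :: "real \<Rightarrow> (real \<Rightarrow> real) \<Rightarrow> real \<Rightarrow> real \<Rightarrow> bool" where
  "has_frac_laplacian \<alpha> g x v \<longleftrightarrow>
     (\<exists>I. has_principal_value (\<lambda>y. (g x - g y) / \<bar>x - y\<bar> powr (1 + 2 * \<alpha>)) x {0<..<1} I \<and>
        v = frac_lap_const \<alpha> *
              (I + g x / (2 * \<alpha>) * (x powr (- 2 * \<alpha>) + (1 - x) powr (- 2 * \<alpha>))))"

text \<open>Continuity on \<open>[0,1]\<close> expresses that the boundary values 0 are attained as limits.
  Prescribing \<open>g 0\<close> and \<open>g 1\<close> alone would not constrain \<open>g\<close> on \<open>]0,1[\<close> at all, and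
  uniqueness would fail: \<open>(x (1 - x)) powr (\<alpha> - 1)\<close> solves the homogeneous equation.\<close>
definition dirichlet_solution :: "real \<Rightarrow> (real \<Rightarrow> real) \<Rightarrow> (real \<Rightarrow> real) \<Rightarrow> bool" where
  "dirichlet_solution \<alpha> h g \<longleftrightarrow>
     locally_contracting_on 0 1 g \<and>
     continuous_on {0..1} g \<and> g 0 = 0 \<and> g 1 = 0 \<and>
     (\<forall>x\<in>{0<..<1}. has_frac_laplacian \<alpha> g x (h x))"

text \<open>The value 0 at \<open>(0,0)\<close> is part of the definition. At the remaining excluded points (the
  diagonal and the rest of the boundary) 0 is a default that does not affect the integral
  below.\<close>
definition green :: "real \<Rightarrow> real \<Rightarrow> real \<Rightarrow> real" where
  "green \<alpha> x y =
     (if 0 < x \<and> x < 1 \<and> 0 < y \<and> y < 1 \<and> x \<noteq> y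
      then 1 / (Gamma \<alpha>)\<^sup>2 * x powr \<alpha> * y powr \<alpha> *
           (LINT t : {max x y..1} | lborel.
              (t - x) powr (\<alpha> - 1) * (t - y) powr (\<alpha> - 1) / t powr (2 * \<alpha>))
      else 0)"

definition green_solution :: "real \<Rightarrow> (real \<Rightarrow> real) \<Rightarrow> real \<Rightarrow> real" where
  "green_solution \<alpha> h x =
     (if 0 < x \<and> x < 1 then (LINT y : {0..1} | lborel. green \<alpha> x y * h y) else 0)"

end

theory Submission
  imports Defs
begin

text \<open>For \<open>2 \<alpha> < 1\<close> the fractional Laplacian of a locally Lipschitz \<open>u\<close>, extended by 0, is up to
  the factor \<open>frac_lap_const \<alpha> / (2 \<alpha>)\<close> the derivative of the odd potential
  \<open>s \<mapsto> \<integral> u(z) sgn(s - z) \<bar>s - z\<bar>\<^sup>-\<^sup>2\<^sup>\<alpha> dz\<close>. So it suffices to know the odd potential of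
  \<open>z \<mapsto> G(z, y)\<close> at \<open>x\<close>. For \<open>x < y\<close> the integral representation of \<open>G\<close> reduces it to
  \<open>\<integral>\<^sub>0\<^sup>t z\<^sup>\<alpha> (t - z)\<^sup>\<alpha>\<^sup>-\<^sup>1 sgn(x - z) \<bar>x - z\<bar>\<^sup>-\<^sup>2\<^sup>\<alpha> dz\<close> with \<open>x < t\<close>, which is the constant
  \<open>- B(\<alpha>, 1 - \<alpha>)\<close>; the result is minus a constant times an incomplete beta function of \<open>1 - y\<close>. The
  case \<open>y < x\<close> follows from the symmetry \<open>G(1 - x, 1 - y) = G(x, y)\<close>, which becomes visible after the
  substitution \<open>s = min x y (t - max x y) / t\<close> in the definition of \<open>G\<close>. The two incomplete beta
  functions add up to \<open>B(\<alpha>, \<alpha>)\<close>, hence the odd potential of \<open>\<integral> G(\<cdot>, y) h(y) dy\<close> is a constant plus a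
  multiple of \<open>\<integral>\<^sub>0\<^sup>x h\<close>, and Legendre's duplication formula identifies the multiple. Uniqueness is the
  maximum principle.\<close>

text \<open>The fractional Laplacian of \<open>G(z, y)\<close> in z alone is formally a point mass
  at y. The odd potential is one derivative weaker: as 2 \<alpha> < 1 its kernel is locally
  integrable, the point mass becomes a jump across x = y, and all exchanges of integrals concern
  absolutely convergent ones. On either side of the jump the potential of \<open>G(z, y)\<close>
  does not depend on x, so after integration against h only the jump height times the integral of h
  up to x survives differentiation. The price is regularity. Going back from the derivative of the
  potential to the principal value needs a solution that is Lipschitz at the point, while G blows up
  on the diagonal. The Lipschitz bound is therefore taken from h: the singular part of G is a
  convolution kernel, and translation moves the increment onto h. The boundary weights in the
  definition of the fractional Laplacian are the derivative of the potential of the constant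
  function 1 on the unit interval.\<close>

section \<open>Power integrals and changes of variables\<close>

text \<open>No integrability hypothesis is needed: if one side is not integrable, neither is the
  other, and both integrals take the default value 0. \<open>F\<close> is kept apart from the
  product with the derivative, so that a caller can supply a closed form and check it pointwise on
  \<open>S\<close>.\<close>

lemma set_lborel_change_of_variables:
  fixes f F g g' :: "real \<Rightarrow> real"
  assumes [measurable]: "S \<in> sets borel" "T \<in> sets borel"
      "f \<in> borel_measurable borel" "F \<in> borel_measurable borel"
    and der: "\<And>x. x \<in> S \<Longrightarrow> (g has_field_derivative g' x) (at x)"
    and bij: "bij_betw g S T"
    and F: "\<And>x. x \<in> S \<Longrightarrow> F x = \<bar>g' x\<bar> * f (g x)"
  shows "set_integrable lborel T f \<longleftrightarrow> set_integrable lborel S F"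
    and "(LINT x:T|lborel. f x) = (LINT x:S|lborel. F x)"
proof -
  have leb: "set_integrable lebesgue A u \<longleftrightarrow> set_integrable lborel A u"
    if "A \<in> sets borel" "u \<in> borel_measurable borel" for A and u :: "real \<Rightarrow> real"
    using that unfolding set_integrable_def by (intro integrable_completion) auto
  have img: "g ` S = T" using bij by (simp add: bij_betw_def)
  have "(\<lambda>x. \<bar>g' x\<bar> * f (g x)) absolutely_integrable_on S \<longleftrightarrow> F absolutely_integrable_on S"
    by (intro set_integrable_cong) (auto simp: F)
  moreover have "integral S (\<lambda>x. \<bar>g' x\<bar> * f (g x)) = integral S F"
    by (intro integral_cong) (auto simp: F)
  ultimately have iff: "F absolutely_integrable_on S \<and> integral S F = b \<longleftrightarrow>
      f absolutely_integrable_on T \<and> integral T f = b" for b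
    using has_absolute_integral_change_of_variables_1'[of S g g' f b] bij der img
    by (auto simp: bij_betw_def intro: has_field_derivative_at_within)
  then show *: "set_integrable lborel T f \<longleftrightarrow> set_integrable lborel S F"
    by (simp add: leb) blast
  show "(LINT x:T|lborel. f x) = (LINT x:S|lborel. F x)"
  proof (cases "set_integrable lborel T f")
    case True
    with * have "set_integrable lborel S F" by simp
    with True iff[of "integral S F"] show ?thesis
      by (simp add: set_borel_integral_eq_integral leb)
  next
    case False
    with * show ?thesis
      by (simp add: set_integrable_def set_lebesgue_integral_def not_integrable_integral_eq)
  qed
qed

lemma
  fixes p r :: real
  assumes "-1 < p" "0 \<le> r"
  shows set_integrable_powr_from_0: "set_integrable lborel {0..r} (\<lambda>y. y powr p)"
    and set_integral_powr_from_0: "(LINT y:{0..r}|lborel. y powr p) = r powr (p + 1) / (p + 1)"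
proof -
  have hi: "((\<lambda>y. y powr p) has_integral (r powr (p + 1) / (p + 1))) {0..r}"
    using has_integral_powr_from_0[OF assms] .
  then have "(\<lambda>y. y powr p) absolutely_integrable_on {0..r}"
    by (intro nonnegative_absolutely_integrable_1) auto
  then show int: "set_integrable lborel {0..r} (\<lambda>y. y powr p)"
    unfolding set_integrable_def by (subst (asm) integrable_completion) auto
  show "(LINT y:{0..r}|lborel. y powr p) = r powr (p + 1) / (p + 1)"
    using set_borel_integral_eq_integral(2)[OF int] hi by (simp add: integral_unique)
qed

lemma
  fixes p r x :: real
  assumes "-1 < p" "0 \<le> r"
  shows set_integrable_abs_powr: "set_integrable lborel {x-r..x+r} (\<lambda>y. \<bar>x - y\<bar> powr p)"
    and set_integral_abs_powr:
      "(LINT y:{x-r..x+r}|lborel. \<bar>x - y\<bar> powr p) = 2 * r powr (p + 1) / (p + 1)"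
proof -
  let ?f = "\<lambda>y. \<bar>x - y\<bar> powr p" and ?g = "\<lambda>y::real. y powr p"
  let ?v = "r powr (p + 1) / (p + 1)"
  have bij1: "bij_betw (\<lambda>y. y - x) {x..x+r} {0..r}"
    by (rule bij_betwI[where g="\<lambda>y. y + x"]) auto
  have bij2: "bij_betw (\<lambda>y. x - y) {x-r..x} {0..r}"
    by (rule bij_betwI[where g="\<lambda>y. x - y"]) auto
  have der1: "((\<lambda>y. y - x) has_real_derivative 1) (at z)" for z
    by (auto intro!: derivative_eq_intros)
  have der2: "((\<lambda>y. x - y) has_real_derivative -1) (at z)" for z
    by (auto intro!: derivative_eq_intros)
  note cov1 = set_lborel_change_of_variables[where f="?g" and F="?f", OF _ _ _ _ der1 bij1]
  note cov2 = set_lborel_change_of_variables[where f="?g" and F="?f", OF _ _ _ _ der2 bij2]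
  have 1: "set_integrable lborel {x..x+r} ?f" "(LINT y:{x..x+r}|lborel. ?f y) = ?v"
    using cov1 set_integrable_powr_from_0[OF assms] set_integral_powr_from_0[OF assms]
    by auto
  have 2: "set_integrable lborel {x-r..x} ?f" "(LINT y:{x-r..x}|lborel. ?f y) = ?v"
    using cov2 set_integrable_powr_from_0[OF assms] set_integral_powr_from_0[OF assms]
    by auto
  have 3: "set_integrable lborel {x<..x+r} ?f"
    by (rule set_integrable_subset[OF 1(1)]) auto
  have eq: "(LINT y:{x<..x+r}|lborel. ?f y) = ?v"
    unfolding 1(2)[symmetric]
    by (rule set_integral_discrete_difference[of "{x}"]) auto
  have un: "{x-r..x+r} = {x-r..x} \<union> {x<..x+r}" using assms by auto
  show "set_integrable lborel {x-r..x+r} ?f"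
    unfolding un by (intro set_integrable_Un 2 3) auto
  show "(LINT y:{x-r..x+r}|lborel. ?f y) = 2 * r powr (p + 1) / (p + 1)"
    unfolding un by (subst set_integral_Un) (use 2 3 eq in auto)
qed

text \<open>[0,1] lies within distance 1 of each of its points, so the exact integral over the
  symmetric interval of radius 1 gives a bound that is uniform in \<open>x\<close>.\<close>

lemma
  fixes p x :: real
  assumes "-1 < p" "x \<in> {0..1}"
  shows set_integrable_abs_powr_unit: "set_integrable lborel {0..1} (\<lambda>y. \<bar>x - y\<bar> powr p)"
    and set_integral_abs_powr_unit_le: "(LINT y:{0..1}|lborel. \<bar>x - y\<bar> powr p) \<le> 2 / (p + 1)"
proof -
  note I = set_integrable_abs_powr[of p 1 x]
  show *: "set_integrable lborel {0..1} (\<lambda>y. \<bar>x - y\<bar> powr p)"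
    by (rule set_integrable_subset[OF I]) (use assms in auto)
  have "(LINT y:{0..1}|lborel. \<bar>x - y\<bar> powr p) \<le> (LINT y:{x-1..x+1}|lborel. \<bar>x - y\<bar> powr p)"
    unfolding set_lebesgue_integral_def
    by (rule integral_mono)
       (use * I assms in \<open>auto simp: set_integrable_def indicator_def\<close>)
  then show "(LINT y:{0..1}|lborel. \<bar>x - y\<bar> powr p) \<le> 2 / (p + 1)"
    using set_integral_abs_powr[of p 1 x] assms by simp
qed

lemma
  fixes a b :: real
  assumes "0 < a" "0 < b"
  shows set_integrable_Beta:
      "set_integrable lborel {0<..<1} (\<lambda>s. s powr (a - 1) * (1 - s) powr (b - 1))"
    and set_integral_Beta:
      "(LINT s:{0<..<1}|lborel. s powr (a - 1) * (1 - s) powr (b - 1)) = Beta a b"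
proof -
  let ?f = "\<lambda>s. s powr (a - 1) * (1 - s) powr (b - 1)"
  have hi: "(?f has_integral Beta a b) {0..1}"
    using has_integral_Beta_real[OF assms] .
  then have "?f absolutely_integrable_on {0..1}"
    by (intro nonnegative_absolutely_integrable_1) auto
  then have int: "set_integrable lborel {0..1} ?f"
    unfolding set_integrable_def by (subst (asm) integrable_completion) auto
  then show "set_integrable lborel {0<..<1} ?f"
    by (rule set_integrable_subset) auto
  have "(LINT s:{0<..<1}|lborel. ?f s) = (LINT s:{0..1}|lborel. ?f s)"
    by (rule set_integral_discrete_difference[of "{0,1}"]) auto
  then show "(LINT s:{0<..<1}|lborel. ?f s) = Beta a b"
    using set_borel_integral_eq_integral(2)[OF int] hi by (simp add: integral_unique)
qed

section \<open>The Green kernel as a potential\<close>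

text \<open>The Green function in separated variables: p = min x y * (1 - max x y) carries the
  boundary and d = |x - y| the diagonal; see \<open>green_eq_kernel\<close>. A cut at a fixed upper
  limit then isolates the singularity.\<close>

definition green_kernel :: "real \<Rightarrow> real \<Rightarrow> real \<Rightarrow> real" where
  "green_kernel \<alpha> p d =
     (LINT s:{0<..<p}|lborel. s powr (\<alpha> - 1) * (s + d) powr (\<alpha> - 1))"

context
  fixes \<alpha> :: real
  assumes \<alpha>: "0 < \<alpha>" "\<alpha> < 1 / 2"
begin

lemma set_integrable_green_kernel:
  assumes "0 < d"
  shows "set_integrable lborel {0<..<p} (\<lambda>s. s powr (\<alpha> - 1) * (s + d) powr (\<alpha> - 1))"
proof (cases "0 \<le> p")
  case True
  have "set_integrable lborel {0<..<p} (\<lambda>s. s powr (\<alpha> - 1) * d powr (\<alpha> - 1))"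
    by (rule set_integrable_mult_left, rule set_integrable_subset[OF set_integrable_powr_from_0[of _ p]])
       (use \<alpha> True in auto)
  then show ?thesis
    by (rule set_integrable_bound)
       (use \<alpha> assms in \<open>auto simp: set_borel_measurable_def abs_mult intro!: mult_left_mono powr_mono2'\<close>)
qed auto

lemma green_kernel_nonneg: "0 \<le> green_kernel \<alpha> p d"
  unfolding green_kernel_def set_lebesgue_integral_def by (rule integral_nonneg_AE) auto

text \<open>As \<alpha> - 1 < 0, the factor in s + d is at most its value at s = 0, and a pure power
  remains. The true singularity is only of order d^(2\<alpha>-1), but d^(\<alpha>-1) is integrable
  as well, and the factor p^\<alpha> records the decay at the boundary.\<close>

lemma green_kernel_le:
  assumes "0 < d" "0 \<le> p"
  shows "green_kernel \<alpha> p d \<le> p powr \<alpha> / \<alpha> * d powr (\<alpha> - 1)"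
proof -
  note int = set_integrable_powr_from_0[of "\<alpha> - 1" p] 
  have "green_kernel \<alpha> p d \<le> (LINT s:{0..p}|lborel. s powr (\<alpha> - 1) * d powr (\<alpha> - 1))"
    unfolding green_kernel_def set_lebesgue_integral_def
    using set_integrable_green_kernel[OF assms(1), of p] set_integrable_mult_left[OF int, of "d powr (\<alpha> - 1)"] \<alpha> assms
    by (intro integral_mono)
       (auto simp: set_integrable_def indicator_def intro!: mult_left_mono powr_mono2')
  also have "\<dots> = p powr \<alpha> / \<alpha> * d powr (\<alpha> - 1)"
    using set_integral_powr_from_0[of "\<alpha> - 1" p] \<alpha> assms by simp
  finally show ?thesis .
qed

text \<open>The substitution is t = m M / (m - s). Then t - m and t - M become m (s + M - m) / (m -
  s) and M s / (m - s), and the powers of m - s from the two factors, from t^(-2\<alpha>) and from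
  the Jacobian cancel exactly.\<close>

lemma
  assumes "0 < m" "m < M" "M < 1"
  shows set_integrable_green_aux:
      "set_integrable lborel {M<..<1}
         (\<lambda>t. (t - m) powr (\<alpha> - 1) * (t - M) powr (\<alpha> - 1) / t powr (2 * \<alpha>))"
    and green_aux: "(LINT t:{M..1}|lborel.
         (t - m) powr (\<alpha> - 1) * (t - M) powr (\<alpha> - 1) / t powr (2 * \<alpha>)) =
       (m * M) powr (-\<alpha>) * green_kernel \<alpha> (m * (1 - M)) (M - m)"
proof -
  let ?f = "\<lambda>t. (t - m) powr (\<alpha> - 1) * (t - M) powr (\<alpha> - 1) / t powr (2 * \<alpha>)"
  let ?F = "\<lambda>s. (m * M) powr (-\<alpha>) * (s powr (\<alpha> - 1) * (s + (M - m)) powr (\<alpha> - 1))"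
  let ?S = "{0<..<m * (1 - M)}"
  have lt: "s < m" if "s \<in> ?S" for s
    using that assms by (simp add: right_diff_distrib) (smt (verit) mult_pos_pos)
  have der: "((\<lambda>s. m * M / (m - s)) has_real_derivative m * M / (m - s)\<^sup>2) (at s)"
    if "s \<in> ?S" for s
    using lt[OF that] assms
    by (auto intro!: derivative_eq_intros simp: power2_eq_square field_simps)
  have bij: "bij_betw (\<lambda>s. m * M / (m - s)) ?S {M<..<1}"
  proof (rule bij_betwI[where g="\<lambda>t. m * (t - M) / t"])
    show "(\<lambda>s. m * M / (m - s)) \<in> ?S \<rightarrow> {M<..<1}"
    proof
      fix s assume s: "s \<in> ?S"
      then have "M * (m - s) < M * m" "m * M < 1 * (m - s)"
        using assms by (auto simp: right_diff_distrib)
      then show "m * M / (m - s) \<in> {M<..<1}"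
        using lt[OF s] by (simp add: pos_less_divide_eq pos_divide_less_eq mult.commute)
    qed
    show "(\<lambda>t. m * (t - M) / t) \<in> {M<..<1} \<rightarrow> ?S"
    proof
      fix t assume t: "t \<in> {M<..<1}"
      then have "m * (M * t) < m * (M * 1)"
        using assms by (intro mult_strict_left_mono) auto
      moreover have "0 < t" using t assms by auto
      ultimately have "m * (t - M) / t < m * (1 - M)"
        by (subst pos_divide_less_eq) (auto simp: algebra_simps)
      then show "m * (t - M) / t \<in> ?S" using t assms \<open>0 < t\<close> by simp
    qed
    show "m * (m * M / (m - s) - M) / (m * M / (m - s)) = s" if "s \<in> ?S" for s
    proof -
      have "m * M / (m - s) - M = M * s / (m - s)"
        using lt[OF that] by (simp add: field_simps)
      then show ?thesis using lt[OF that] assms by simp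
    qed
    show "m * M / (m - m * (t - M) / t) = t" if "t \<in> {M<..<1}" for t
    proof -
      have "m - m * (t - M) / t = m * M / t"
        using that assms by (simp add: field_simps)
      then show ?thesis using that assms by simp
    qed
  qed
  have F: "?F s = \<bar>m * M / (m - s)\<^sup>2\<bar> * ?f (m * M / (m - s))" if s: "s \<in> ?S" for s
  proof -
    have eq: "m * M / (m - s) - m = m * (s + (M - m)) / (m - s)"
         "m * M / (m - s) - M = M * s / (m - s)"
      using lt[OF s] by (auto simp: field_simps)
    \<comment> \<open>Both sides are positive, so it is enough to compare logarithms, which turns
      the identity between products of powers into a linear one. The later substitutions are checked
      in the same way.\<close>
    have "ln (?F s) = ln (\<bar>m * M / (m - s)\<^sup>2\<bar> * ?f (m * M / (m - s)))"
      unfolding eq using lt[OF s] s assms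
      by (simp add: ln_mult ln_div ln_realpow) (simp add: algebra_simps)
    then show ?thesis
      unfolding eq using lt[OF s] s assms by (subst (asm) ln_inj_iff) auto
  qed
  note cov = set_lborel_change_of_variables[where f="?f" and F="?F", OF _ _ _ _ der bij F]
  have "set_integrable lborel ?S ?F"
    by (intro set_integrable_mult_right set_integrable_green_kernel) (use assms in auto)
  then show "set_integrable lborel {M<..<1} ?f"
    using cov by auto
  have "(LINT t:{M..1}|lborel. ?f t) = (LINT t:{M<..<1}|lborel. ?f t)"
    by (rule set_integral_discrete_difference[of "{M,1}"]) auto
  then show "(LINT t:{M..1}|lborel. ?f t) =
       (m * M) powr (-\<alpha>) * green_kernel \<alpha> (m * (1 - M)) (M - m)"
    using cov by (auto simp: green_kernel_def)
qed

lemma set_integrable_green: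
  assumes "0 < x" "x < 1" "0 < y" "y < 1" "x \<noteq> y"
  shows "set_integrable lborel {max x y<..<1}
         (\<lambda>t. (t - x) powr (\<alpha> - 1) * (t - y) powr (\<alpha> - 1) / t powr (2 * \<alpha>))"
proof (cases "x < y")
  case True
  then show ?thesis using set_integrable_green_aux[of x y] assms by (simp add: max_def)
next
  case False
  then show ?thesis using set_integrable_green_aux[of y x] assms
    by (simp add: max_def mult.commute)
qed

lemma green_eq_kernel:
  assumes "0 < x" "x < 1" "0 < y" "y < 1" "x \<noteq> y"
  shows "green \<alpha> x y = green_kernel \<alpha> (min x y * (1 - max x y)) \<bar>x - y\<bar> / (Gamma \<alpha>)\<^sup>2"
proof (cases "x < y")
  case True
  then show ?thesis using green_aux[of x y] assms
    by (simp add: green_def max_def min_def powr_mult powr_minus field_simps abs_if)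
next
  case False
  then show ?thesis using green_aux[of y x] assms
    by (simp add: green_def max_def min_def powr_mult powr_minus field_simps abs_if)
qed

lemma green_nonneg: "0 \<le> green \<alpha> x y"
  using green_eq_kernel[of x y] green_kernel_nonneg by (auto simp: green_def)

lemma green_commute: "green \<alpha> x y = green \<alpha> y x"
  by (auto simp: green_def ac_simps)

lemma green_reflect: "green \<alpha> (1 - x) (1 - y) = green \<alpha> x y"
proof (cases "0 < x \<and> x < 1 \<and> 0 < y \<and> y < 1 \<and> x \<noteq> y")
  case True
  moreover have "min (1 - x) (1 - y) * (1 - max (1 - x) (1 - y)) = min x y * (1 - max x y)"
    by (auto simp: min_def max_def)
  ultimately show ?thesis
    using green_eq_kernel[of x y] green_eq_kernel[of "1 - x" "1 - y"]
    by (simp add: abs_minus_commute)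
qed (auto simp: green_def)

text \<open>min x y is at most x and max x y at least x, so p is at most x (1 - x). The first factor
  forces the boundary values 0, and the second is integrable in y with a bound uniform in x.\<close>

lemma green_le:
  assumes "x \<in> {0..1}"
  shows "green \<alpha> x y \<le> (x * (1 - x)) powr \<alpha> / (\<alpha> * (Gamma \<alpha>)\<^sup>2) * \<bar>x - y\<bar> powr (\<alpha> - 1)"
proof (cases "0 < x \<and> x < 1 \<and> 0 < y \<and> y < 1 \<and> x \<noteq> y")
  case True
  let ?p = "min x y * (1 - max x y)"
  have "?p \<le> x * (1 - x)"
    using True by (intro mult_mono) auto
  moreover have "0 \<le> ?p" using True by auto
  ultimately have "green_kernel \<alpha> ?p \<bar>x - y\<bar> \<le> (x * (1 - x)) powr \<alpha> / \<alpha> * \<bar>x - y\<bar> powr (\<alpha> - 1)"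
    using green_kernel_le[of "\<bar>x - y\<bar>" ?p] True \<alpha>
    by (smt (verit) divide_right_mono mult_right_mono powr_ge_zero powr_mono2)
  from divide_right_mono[OF this, of "(Gamma \<alpha>)\<^sup>2"] show ?thesis
    using True by (simp add: green_eq_kernel)
qed (use \<alpha> in \<open>auto simp: green_def\<close>)

text \<open>Joint measurability is what Fubini requires. The domain of the inner integral moves with
  (x, y), so it is first written as a condition inside the integrand.\<close>

lemma borel_measurable_green [measurable]:
  "(\<lambda>(x, y). green \<alpha> x y) \<in> borel_measurable (borel \<Otimes>\<^sub>M borel)"
proof -
  have "(\<lambda>(x, y). green \<alpha> x y) = (\<lambda>(x, y).
     if 0 < x \<and> x < 1 \<and> 0 < y \<and> y < 1 \<and> x \<noteq> y
     then 1 / (Gamma \<alpha>)\<^sup>2 * x powr \<alpha> * y powr \<alpha> *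
       (\<integral>t. (if x \<le> t \<and> y \<le> t \<and> t \<le> 1 
         then (t - x) powr (\<alpha> - 1) * (t - y) powr (\<alpha> - 1) / t powr (2 * \<alpha>) else 0) \<partial>lborel)
     else 0)"
    by (intro ext)
       (auto simp: green_def set_lebesgue_integral_def indicator_def intro!: Bochner_Integration.integral_cong)
  also have "\<dots> \<in> borel_measurable (borel \<Otimes>\<^sub>M borel)" by measurable
  finally show ?thesis .
qed

lemma borel_measurable_green' [measurable (raw)]:
  "f \<in> borel_measurable M \<Longrightarrow> g \<in> borel_measurable M \<Longrightarrow>
    (\<lambda>x. green \<alpha> (f x) (g x)) \<in> borel_measurable M"
  using measurable_compose[OF measurable_Pair borel_measurable_green] by simp

end

section \<open>An Abel integral of the odd Riesz kernel\<close>

text \<open>Continuity carries strict monotonicity up to the end points, so a derivative that is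
  positive only in the interior suffices; in \<open>difference\<close> it vanishes at 1.\<close>

lemma bij_betw_open_interval_if_deriv_pos:
  fixes g :: "real \<Rightarrow> real"
  assumes "a < b" and cont: "continuous_on {a..b} g"
    and der: "\<And>x. x \<in> {a<..<b} \<Longrightarrow> (g has_field_derivative g' x) (at x)"
    and pos: "\<And>x. x \<in> {a<..<b} \<Longrightarrow> 0 < g' x"
  shows "bij_betw g {a<..<b} {g a<..<g b}"
proof -
  have less: "g u < g v" if "a \<le> u" "u < v" "v \<le> b" for u v
  proof (rule DERIV_pos_imp_increasing_open[OF that(2)])
    show "\<exists>y. (g has_real_derivative y) (at x) \<and> 0 < y" if "u < x" "x < v" for x
      using der[of x] pos[of x] that \<open>a \<le> u\<close> \<open>v \<le> b\<close> by auto
    show "continuous_on {u..v} g"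
      using that by (intro continuous_on_subset[OF cont]) auto
  qed
  have inj: "inj_on g {a<..<b}"
  proof (rule linorder_inj_onI)
    show "g u \<noteq> g v" if "u < v" "u \<in> {a<..<b}" "v \<in> {a<..<b}" for u v
      using less[of u v] that by simp
  qed auto
  have "g ` {a<..<b} = {g a<..<g b}"
  proof (intro equalityI subsetI)
    fix w assume w: "w \<in> {g a<..<g b}"
    then obtain u where "a \<le> u" "u \<le> b" "g u = w"
      using IVT'[of g a w b] cont assms(1) by auto
    with w show "w \<in> g ` {a<..<b}" by (cases "u = a \<or> u = b") auto
  qed (use less in fastforce)
  with inj show ?thesis by (simp add: bij_betw_def)
qed

lemma bij_betw_open_interval_if_deriv_neg:
  fixes g :: "real \<Rightarrow> real"
  assumes "a < b" and cont: "continuous_on {a..b} g"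
    and der: "\<And>x. x \<in> {a<..<b} \<Longrightarrow> (g has_field_derivative g' x) (at x)"
    and neg: "\<And>x. x \<in> {a<..<b} \<Longrightarrow> g' x < 0"
  shows "bij_betw g {a<..<b} {g b<..<g a}"
proof -
  have "bij_betw (\<lambda>x. - g x) {a<..<b} {- g a<..<- g b}"
    by (rule bij_betw_open_interval_if_deriv_pos[where g'="\<lambda>x. - g' x"])
       (use assms in \<open>auto intro!: continuous_on_minus DERIV_minus\<close>)
  moreover have "bij_betw uminus {- g a<..<- g b} {g b<..<g a}"
    by (rule bij_betwI[where g=uminus]) auto
  ultimately have "bij_betw (uminus \<circ> (\<lambda>x. - g x)) {a<..<b} {g b<..<g a}"
    by (rule bij_betw_trans)
  then show ?thesis by (simp add: comp_def)
qed

text \<open>On each half line an antiderivative of -2 \<alpha> |s|^(-1-2\<alpha>), which is a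
  multiple of the kernel of the fractional Laplacian. For 2 \<alpha> < 1 it is locally integrable,
  which that kernel is not.\<close>

definition odd_kernel :: "real \<Rightarrow> real \<Rightarrow> real" where
  "odd_kernel \<alpha> s = sgn s * \<bar>s\<bar> powr (- 2 * \<alpha>)"

lemma borel_measurable_odd_kernel [measurable]: "odd_kernel \<alpha> \<in> borel_measurable borel"
  unfolding odd_kernel_def by measurable

lemma odd_kernel_minus: "odd_kernel \<alpha> (- s) = - odd_kernel \<alpha> s"
  by (simp add: odd_kernel_def)

lemma abs_odd_kernel: "\<bar>odd_kernel \<alpha> s\<bar> = \<bar>s\<bar> powr (- 2 * \<alpha>)"
  by (simp add: odd_kernel_def abs_mult abs_sgn_eq)

context
  fixes \<alpha> :: real
  assumes \<alpha>: "0 < \<alpha>" "\<alpha> < 1 / 2"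
begin

context
  fixes x t A C :: real
  assumes x: "0 < x" "x < t"
  defines "A \<equiv> t - x" and "C \<equiv> t powr (2 * \<alpha>) * x powr (1 - \<alpha>) * (t - x) powr (- \<alpha>)"
begin

text \<open>\<open>F1\<close> and \<open>F2\<close> are the integrands to the left and to the right
  of x, pulled back to the unit interval by the substitutions described before
  \<open>left_part\<close>. \<open>C\<close> collects the powers that do not involve r.\<close>

private definition "F1 r = C * (r powr \<alpha> * (1 - r) powr (- 2 * \<alpha>) / (A + x * r))" for r
private definition "F2 r = C * (r powr (\<alpha> - 1) * (1 - r) powr (- 2 * \<alpha>) / (A * r + x))" for r

private lemma A: "0 < A" "t = A + x" "0 < t"
  using x by (auto simp: A_def)

private lemma C: "0 < C" "C = t powr (2 * \<alpha>) * x powr (1 - \<alpha>) * A powr (- \<alpha>)"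
  using x by (auto simp: C_def A_def)

private lemma [measurable]: "F1 \<in> borel_measurable borel" "F2 \<in> borel_measurable borel"
  unfolding F1_def F2_def by measurable

text \<open>The denominator is at least \<open>A\<close>, so a multiple of a beta integrand
  dominates; its exponent -2 \<alpha> at r = 1 is integrable because 2 \<alpha> < 1. The same works
  for \<open>F2\<close> with the lower bound x.\<close>

private lemma integrable_F1: "set_integrable lborel {0<..<1} F1"
proof -
  have int: "set_integrable lborel {0<..<1} (\<lambda>r. C / A * (r powr \<alpha> * (1 - r) powr (- 2 * \<alpha>)))"
    using set_integrable_Beta[of "1 + \<alpha>" "1 - 2 * \<alpha>"] \<alpha>
    by (intro set_integrable_mult_right) simp
  have bound: "norm (F1 r) \<le> norm (C / A * (r powr \<alpha> * (1 - r) powr (- 2 * \<alpha>)))"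
    if "r \<in> {0<..<1}" for r
  proof -
    have "r powr \<alpha> * (1 - r) powr (- 2 * \<alpha>) / (A + x * r) \<le> r powr \<alpha> * (1 - r) powr (- 2 * \<alpha>) / A"
      using A(1) x that by (intro divide_left_mono mult_pos_pos) (auto intro: add_pos_pos)
    from mult_left_mono[OF this, of C] A(1) C(1) x that show ?thesis
      by (simp add: F1_def abs_mult)
  qed
  show ?thesis
  proof (rule set_integrable_bound[OF int])
    show "set_borel_measurable lborel {0<..<1} F1"
      unfolding set_borel_measurable_def by measurable
  qed (intro AE_I2 impI bound)
qed

private lemma integrable_F2: "set_integrable lborel {0<..<1} F2"
proof -
  have int: "set_integrable lborel {0<..<1} (\<lambda>r. C / x * (r powr (\<alpha> - 1) * (1 - r) powr (- 2 * \<alpha>)))"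
    using set_integrable_Beta[of "\<alpha>" "1 - 2 * \<alpha>"] \<alpha>
    by (intro set_integrable_mult_right) simp
  have bound: "norm (F2 r) \<le> norm (C / x * (r powr (\<alpha> - 1) * (1 - r) powr (- 2 * \<alpha>)))"
    if "r \<in> {0<..<1}" for r
  proof -
    have "r powr (\<alpha> - 1) * (1 - r) powr (- 2 * \<alpha>) / (A * r + x) \<le> r powr (\<alpha> - 1) * (1 - r) powr (- 2 * \<alpha>) / x"
      using A(1) x that by (intro divide_left_mono mult_pos_pos) (auto intro: add_pos_pos)
    from mult_left_mono[OF this, of C] A(1) C(1) x that show ?thesis
      by (simp add: F2_def abs_mult)
  qed
  show ?thesis
  proof (rule set_integrable_bound[OF int])
    show "set_borel_measurable lborel {0<..<1} F2"
      unfolding set_borel_measurable_def by measurable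
  qed (intro AE_I2 impI bound)
qed

text \<open>With \<open>\<zeta> = z / (t - z)\<close> and \<open>\<xi> = x / (t - x)\<close> the next two substitutions are \<open>\<zeta> = \<xi> r\<close> and
  \<open>\<zeta> = \<xi> / r\<close>: they pair the two sides of the singularity, and the difference of the resulting
  integrands is again a beta integrand after one more substitution.\<close>
private lemma left_part:
  shows "set_integrable lborel {0<..<x} (\<lambda>z. z powr \<alpha> * (t - z) powr (\<alpha> - 1) * \<bar>x - z\<bar> powr (- 2 * \<alpha>))"
    and "(LINT z:{0<..<x}|lborel. z powr \<alpha> * (t - z) powr (\<alpha> - 1) * \<bar>x - z\<bar> powr (- 2 * \<alpha>))
       = (LINT r:{0<..<1}|lborel. F1 r)"
proof -
  let ?f = "\<lambda>z. z powr \<alpha> * (t - z) powr (\<alpha> - 1) * \<bar>x - z\<bar> powr (- 2 * \<alpha>)"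
  \<comment> \<open>The solution z of z / (t - z) = x r / A.\<close>
  let ?g = "\<lambda>r. t * x * r / (A + x * r)" and ?g' = "\<lambda>r. t * x * A / (A + x * r)\<^sup>2"
  have pos: "0 < A + x * r" if "0 \<le> r" for r
    using A x that by (simp add: add_pos_nonneg)
  have der: "(?g has_real_derivative ?g' r) (at r)" if "r \<in> {0<..<1}" for r
    using pos[of r] that
    by (auto intro!: derivative_eq_intros simp: power2_eq_square divide_simps) algebra
  have bij: "bij_betw ?g {0<..<1} {?g 0<..<?g 1}"
  proof (rule bij_betw_open_interval_if_deriv_pos[OF _ _ der])
    show "continuous_on {0..1} ?g"
      by (intro continuous_intros) (use pos in \<open>force\<close>)
    show "0 < ?g' r" if "r \<in> {0<..<1}" for r
      using pos[of r] that A(1,3) x by simp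
  qed auto
  have bij: "bij_betw ?g {0<..<1} {0<..<x}"
    using bij A by simp
  have F: "F1 r = \<bar>?g' r\<bar> * ?f (?g r)" if r: "r \<in> {0<..<1}" for r
  proof -
    note p = pos[of r]
    have eq: "t - ?g r = t * A / (A + x * r)" "x - ?g r = x * A * (1 - r) / (A + x * r)"
      using p r A by (auto simp: field_simps)
    have ab: "\<bar>x * A * (1 - r) / (A + x * r)\<bar> = x * A * (1 - r) / (A + x * r)"
      using p r A x by auto
    have "ln (F1 r) = ln (\<bar>?g' r\<bar> * ?f (?g r))"
      unfolding eq F1_def C(2) ab using p r A(1,3) x
      by (simp add: ln_mult ln_div ln_realpow) (simp add: algebra_simps)
    then show ?thesis
      unfolding eq F1_def ab using p r A(1,3) x C(1) by (subst (asm) ln_inj_iff) auto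
  qed
  note cov = set_lborel_change_of_variables[where f="?f" and F="F1", OF _ _ _ _ der bij F]
  show "set_integrable lborel {0<..<x} ?f"
    using cov(1) integrable_F1 by simp
  show "(LINT z:{0<..<x}|lborel. ?f z) = (LINT r:{0<..<1}|lborel. F1 r)"
    using cov(2) by simp
qed

private lemma right_part:
  shows "set_integrable lborel {x<..<t} (\<lambda>z. z powr \<alpha> * (t - z) powr (\<alpha> - 1) * \<bar>x - z\<bar> powr (- 2 * \<alpha>))"
    and "(LINT z:{x<..<t}|lborel. z powr \<alpha> * (t - z) powr (\<alpha> - 1) * \<bar>x - z\<bar> powr (- 2 * \<alpha>))
       = (LINT r:{0<..<1}|lborel. F2 r)"
proof -
  let ?f = "\<lambda>z. z powr \<alpha> * (t - z) powr (\<alpha> - 1) * \<bar>x - z\<bar> powr (- 2 * \<alpha>)"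
  \<comment> \<open>The solution z of z / (t - z) = x / (A r). It decreases in r, hence the sign of
    the derivative and the exchanged end points.\<close>
  let ?g = "\<lambda>r. t * x / (A * r + x)" and ?g' = "\<lambda>r. - (t * x * A / (A * r + x)\<^sup>2)"
  have pos: "0 < A * r + x" if "0 \<le> r" for r
    using A x that by (simp add: add_nonneg_pos)
  have der: "(?g has_real_derivative ?g' r) (at r)" if "r \<in> {0<..<1}" for r
    using pos[of r] that
    by (auto intro!: derivative_eq_intros simp: power2_eq_square divide_simps)
  have bij: "bij_betw ?g {0<..<1} {?g 1<..<?g 0}"
  proof (rule bij_betw_open_interval_if_deriv_neg[OF _ _ der])
    show "continuous_on {0..1} ?g"
      by (intro continuous_intros) (use pos in \<open>force\<close>)
    show "?g' r < 0" if "r \<in> {0<..<1}" for r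
      using pos[of r] that A(1,3) x by simp
  qed auto
  have bij: "bij_betw ?g {0<..<1} {x<..<t}"
    using bij A x by simp
  have F: "F2 r = \<bar>?g' r\<bar> * ?f (?g r)" if r: "r \<in> {0<..<1}" for r
  proof -
    note p = pos[of r]
    have eq: "t - ?g r = t * A * r / (A * r + x)" "x - ?g r = - (x * A * (1 - r) / (A * r + x))"
      using p r A by (auto simp: field_simps)
    have ab: "\<bar>- (x * A * (1 - r) / (A * r + x))\<bar> = x * A * (1 - r) / (A * r + x)"
      using p r A x by auto
    have "ln (F2 r) = ln (\<bar>?g' r\<bar> * ?f (?g r))"
      unfolding eq F2_def C(2) ab using p r A(1,3) x
      by (simp add: ln_mult ln_div ln_realpow) (simp add: algebra_simps)
    then show ?thesis
      unfolding eq F2_def ab using p r A(1,3) x C(1) by (subst (asm) ln_inj_iff) auto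
  qed
  note cov = set_lborel_change_of_variables[where f="?f" and F="F2", OF _ _ _ _ der bij F]
  show "set_integrable lborel {x<..<t} ?f"
    using cov(1) integrable_F2 by simp
  show "(LINT z:{x<..<t}|lborel. ?f z) = (LINT r:{0<..<1}|lborel. F2 r)"
    using cov(2) by simp
qed

text \<open>Replacing r by 1/r exchanges the two sides of x, and s = t^2 r / ((A + x r) (A r + x))
  is invariant under this exchange. Moreover 1 - s is a multiple of (1 - r)^2 over the same
  denominator, so the common singularity (1 - r)^(-2\<alpha>) becomes (1 - s)^(-\<alpha>). The
  constants cancel against \<open>C\<close>, which is why x and t disappear from the result.\<close>

private lemma difference:
  "(LINT r:{0<..<1}|lborel. F2 r) - (LINT r:{0<..<1}|lborel. F1 r) = Beta \<alpha> (1 - \<alpha>)"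
proof -
  let ?N = "\<lambda>r. (A + x * r) * (A * r + x)"
  let ?f = "\<lambda>s. s powr (\<alpha> - 1) * (1 - s) powr (1 - \<alpha> - 1)"
  let ?g = "\<lambda>r. t\<^sup>2 * r / ?N r" and ?g' = "\<lambda>r. t\<^sup>2 * A * x * (1 - r\<^sup>2) / (?N r)\<^sup>2"
  have pos: "0 < A + x * r" "0 < A * r + x" if "0 \<le> r" for r
    using A x that by (auto intro: add_pos_nonneg add_nonneg_pos)
  have der: "(?g has_real_derivative ?g' r) (at r)" if "r \<in> {0<..<1}" for r
  proof -
    have "(?g has_real_derivative
       (t\<^sup>2 * ?N r - t\<^sup>2 * r * (x * (A * r + x) + (A + x * r) * A)) / (?N r * ?N r)) (at r)"
      using pos[of r] that
      by (auto intro!: derivative_eq_intros simp: mult.commute)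
    also have "t\<^sup>2 * ?N r - t\<^sup>2 * r * (x * (A * r + x) + (A + x * r) * A) = t\<^sup>2 * A * x * (1 - r\<^sup>2)"
      by algebra
    finally show ?thesis by (simp add: power2_eq_square)
  qed
  have bij: "bij_betw ?g {0<..<1} {?g 0<..<?g 1}"
  proof (rule bij_betw_open_interval_if_deriv_pos[OF _ _ der])
    show "continuous_on {0..1} ?g"
      by (intro continuous_intros) (use pos in \<open>force\<close>)
    show "0 < ?g' r" if "r \<in> {0<..<1}" for r
    proof -
      have "r\<^sup>2 < 1" using that by (simp add: power_less_one_iff)
      then show ?thesis using pos[of r] that A(1,3) x by simp
    qed
  qed auto
  have bij: "bij_betw ?g {0<..<1} {0<..<1}"
    using bij A by (simp add: power2_eq_square)
  have F: "F2 r - F1 r = \<bar>?g' r\<bar> * ?f (?g r)" if r: "r \<in> {0<..<1}" for r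
  proof -
    note p = pos[of r]
    have eq: "1 - ?g r = A * x * (1 - r)\<^sup>2 / ?N r"
      using p r unfolding A(2) by (auto simp: divide_simps) algebra
    have r2: "r\<^sup>2 < 1" "1 - r\<^sup>2 = (1 - r) * (1 + r)"
      using r by (simp_all add: power_less_one_iff) (simp add: power2_eq_square algebra_simps)
    have "F2 r - F1 r = C * r powr (\<alpha> - 1) * (1 - r) powr (- 2 * \<alpha>) * (1 / (A * r + x) - r / (A + x * r))"
      using r powr_mult_base[of r "\<alpha> - 1"] by (simp add: F1_def F2_def algebra_simps)
    also have "1 / (A * r + x) - r / (A + x * r) = A * (1 - r\<^sup>2) / ?N r"
      using p r by (simp add: divide_simps) algebra
    finally have D: "F2 r - F1 r = C * r powr (\<alpha> - 1) * (1 - r) powr (- 2 * \<alpha>) * (A * (1 - r\<^sup>2) / ?N r)" .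
    have "ln (F2 r - F1 r) = ln (\<bar>?g' r\<bar> * ?f (?g r))"
      unfolding eq D C(2) r2(2) using p r A(1,3) x
      by (simp add: ln_mult ln_div ln_realpow) (simp add: algebra_simps)
    then show ?thesis
      unfolding eq D using p r r2 A(1,3) x C(1) by (subst (asm) ln_inj_iff) auto
  qed
  note cov = set_lborel_change_of_variables[where f="?f" and F="\<lambda>r. F2 r - F1 r", OF _ _ _ _ der bij F]
  have "(LINT r:{0<..<1}|lborel. F2 r - F1 r) = Beta \<alpha> (1 - \<alpha>)"
    using cov(2) set_integral_Beta[of \<alpha> "1 - \<alpha>"] \<alpha> by simp
  then show ?thesis
    using integrable_F1 integrable_F2 by simp
qed

lemma set_integral_abel_odd_kernel:
  "(LINT z:{0<..<t}|lborel. z powr \<alpha> * (t - z) powr (\<alpha> - 1) * odd_kernel \<alpha> (x - z)) =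
      - Beta \<alpha> (1 - \<alpha>)"
proof -
  let ?f = "\<lambda>z. z powr \<alpha> * (t - z) powr (\<alpha> - 1) * \<bar>x - z\<bar> powr (- 2 * \<alpha>)"
  let ?k = "\<lambda>z. z powr \<alpha> * (t - z) powr (\<alpha> - 1) * odd_kernel \<alpha> (x - z)"
  have 1: "set_integrable lborel {0<..<x} ?k"
    by (rule set_integrable_cong[THEN iffD1, OF _ _ _ left_part(1)]) (auto simp: odd_kernel_def)
  have "set_integrable lborel {x<..<t} (\<lambda>z. - 1 * ?f z)"
    by (intro set_integrable_mult_right right_part(1))
  then have 2: "set_integrable lborel {x<..<t} ?k"
    by (rule set_integrable_cong[THEN iffD1, rotated -1]) (auto simp: odd_kernel_def)
  have I1: "(LINT z:{0<..<x}|lborel. ?k z) = (LINT r:{0<..<1}|lborel. F1 r)"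
    unfolding left_part(2)[symmetric]
    by (rule set_lebesgue_integral_cong) (auto simp: odd_kernel_def)
  have "(LINT z:{x<..<t}|lborel. ?k z) = (LINT z:{x<..<t}|lborel. - 1 * ?f z)"
    by (rule set_lebesgue_integral_cong) (auto simp: odd_kernel_def)
  also have "\<dots> = - (LINT r:{0<..<1}|lborel. F2 r)"
    unfolding right_part(2)[symmetric] by (subst set_integral_mult_right) simp
  finally have I2: "(LINT z:{x<..<t}|lborel. ?k z) = - (LINT r:{0<..<1}|lborel. F2 r)" .
  have "(LINT z:{0<..<x} \<union> {x<..<t}|lborel. ?k z) = - Beta \<alpha> (1 - \<alpha>)"
    by (subst set_integral_Un) (use 1 2 I1 I2 difference in auto)
  moreover have "(LINT z:{0<..<t}|lborel. ?k z) = (LINT z:{0<..<x} \<union> {x<..<t}|lborel. ?k z)"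
    by (rule set_integral_discrete_difference[of "{x}"]) (use x in auto)
  ultimately show "(LINT z:{0<..<t}|lborel. ?k z) = - Beta \<alpha> (1 - \<alpha>)" by simp
qed

end
end

section \<open>The odd potential of the Green function\<close>

definition incomplete_beta :: "real \<Rightarrow> real \<Rightarrow> real" where
  "incomplete_beta \<alpha> v = (LINT s:{0<..<v}|lborel. s powr (\<alpha> - 1) * (1 - s) powr (\<alpha> - 1))"

lemma borel_measurable_incomplete_beta [measurable]:
  "incomplete_beta \<alpha> \<in> borel_measurable borel"
proof -
  have "incomplete_beta \<alpha> = (\<lambda>v. \<integral>s. (if 0 < s \<and> s < v 
      then s powr (\<alpha> - 1) * (1 - s) powr (\<alpha> - 1) else 0) \<partial>lborel)"
    by (intro ext) (auto simp: incomplete_beta_def set_lebesgue_integral_def indicator_def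
        intro!: Bochner_Integration.integral_cong)
  also have "\<dots> \<in> borel_measurable borel" by measurable
  finally show ?thesis .
qed

lemma incomplete_beta_nonneg: "0 \<le> incomplete_beta \<alpha> v"
  unfolding incomplete_beta_def set_lebesgue_integral_def by (rule integral_nonneg_AE) auto

text \<open>At every z one of the two distances is at least half of |x - y|, so one factor is
  bounded and the other integrable. For the exponents \<alpha> - 1 and -2 \<alpha> used later the
  sum is below -1, so the singularities must not coincide.\<close>

lemma set_integrable_two_singularities:
  fixes p q x y :: real
  assumes pq: "-1 < p" "p \<le> 0" "-1 < q" "q \<le> 0" and xy: "x \<in> {0..1}" "y \<in> {0..1}" "x \<noteq> y"
  shows "set_integrable lborel {0..1} (\<lambda>z. \<bar>y - z\<bar> powr p * \<bar>x - z\<bar> powr q)"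
proof -
  define \<delta> where "\<delta> = \<bar>x - y\<bar> / 2"
  have \<delta>: "0 < \<delta>" using xy by (simp add: \<delta>_def)
  have int: "set_integrable lborel {0..1}
      (\<lambda>z. \<delta> powr p * \<bar>x - z\<bar> powr q + \<delta> powr q * \<bar>y - z\<bar> powr p)"
    by (intro set_integral_add(1) set_integrable_mult_right set_integrable_abs_powr_unit) (use pq xy in auto)
  have bound: "norm (\<bar>y - z\<bar> powr p * \<bar>x - z\<bar> powr q)
      \<le> norm (\<delta> powr p * \<bar>x - z\<bar> powr q + \<delta> powr q * \<bar>y - z\<bar> powr p)" for z
  proof (cases "\<delta> \<le> \<bar>y - z\<bar>")
    case True
    then have "\<bar>y - z\<bar> powr p * \<bar>x - z\<bar> powr q \<le> \<delta> powr p * \<bar>x - z\<bar> powr q"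
      using \<delta> pq by (intro mult_right_mono powr_mono2') auto
    then show ?thesis by (simp add: add_increasing2)
  next
    case False
    then have "\<delta> \<le> \<bar>x - z\<bar>" using xy(3) unfolding \<delta>_def by (simp add: abs_if split: if_splits)
    then have "\<bar>x - z\<bar> powr q * \<bar>y - z\<bar> powr p \<le> \<delta> powr q * \<bar>y - z\<bar> powr p"
      using \<delta> pq by (intro mult_right_mono powr_mono2') auto
    then show ?thesis by (simp add: add_increasing mult.commute)
  qed
  show ?thesis
    by (rule set_integrable_bound[OF int])
       (auto simp: set_borel_measurable_def intro!: AE_I2 bound simp del: real_norm_def)
qed

context
  fixes \<alpha> :: real
  assumes \<alpha>: "0 < \<alpha>" "\<alpha> < 1 / 2"
begin

lemma set_integrable_incomplete_beta:
  assumes "v \<le> 1"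
  shows "set_integrable lborel {0<..<v} (\<lambda>s. s powr (\<alpha> - 1) * (1 - s) powr (\<alpha> - 1))"
  by (rule set_integrable_subset[OF set_integrable_Beta]) (use \<alpha> assms in auto)

lemma incomplete_beta_le: "v \<le> 1 \<Longrightarrow> incomplete_beta \<alpha> v \<le> Beta \<alpha> \<alpha>"
  unfolding incomplete_beta_def set_lebesgue_integral_def
    set_integral_Beta[OF \<alpha>(1) \<alpha>(1), symmetric]
  using set_integrable_incomplete_beta[of v] set_integrable_incomplete_beta[of 1]
  by (intro integral_mono) (auto simp: set_integrable_def indicator_def)

lemma incomplete_beta_reflect:
  assumes "0 < v" "v < 1"
  shows "incomplete_beta \<alpha> v + incomplete_beta \<alpha> (1 - v) = Beta \<alpha> \<alpha>"
proof -
  let ?f = "\<lambda>s. s powr (\<alpha> - 1) * (1 - s) powr (\<alpha> - 1)"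
  have bij: "bij_betw (\<lambda>s. 1 - s) {0<..<1 - v} {v<..<1}"
    by (rule bij_betwI[where g="\<lambda>s. 1 - s"]) auto
  have der: "((\<lambda>s. 1 - s) has_real_derivative - 1) (at s)" for s
    by (auto intro!: derivative_eq_intros)
  note cov = set_lborel_change_of_variables[where f="?f" and F="?f", OF _ _ _ _ der bij]
  have 1: "set_integrable lborel {v<..<1} ?f"
    by (rule set_integrable_subset[OF set_integrable_incomplete_beta[of 1]]) (use assms in auto)
  have "Beta \<alpha> \<alpha> = (LINT s:{0<..<v} \<union> {v<..<1}|lborel. ?f s)"
    unfolding set_integral_Beta[OF \<alpha>(1) \<alpha>(1), symmetric]
    by (rule set_integral_discrete_difference[of "{v}"]) (use assms in auto)
  also have "\<dots> = incomplete_beta \<alpha> v + (LINT s:{v<..<1}|lborel. ?f s)"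
    unfolding incomplete_beta_def
    by (rule set_integral_Un) (use 1 set_integrable_incomplete_beta assms in auto)
  also have "(LINT s:{v<..<1}|lborel. ?f s) = incomplete_beta \<alpha> (1 - v)"
    using cov(2) by (simp add: incomplete_beta_def mult.commute)
  finally show ?thesis by simp
qed

text \<open>This is what remains of the integral representation of G once z has been integrated out.
  With t = y / (1 - s) the exponents of 1 - s add up to -2 - (\<alpha> - 1) + 2 \<alpha> = \<alpha>
  - 1.\<close>

lemma set_integral_green_tail:
  assumes y: "0 < y" "y < 1"
  shows "(LINT t:{y<..<1}|lborel. (t - y) powr (\<alpha> - 1) / t powr (2 * \<alpha>)) =
      y powr (-\<alpha>) * incomplete_beta \<alpha> (1 - y)"
proof -
  let ?f = "\<lambda>t. (t - y) powr (\<alpha> - 1) / t powr (2 * \<alpha>)"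
  let ?F = "\<lambda>s. y powr (-\<alpha>) * (s powr (\<alpha> - 1) * (1 - s) powr (\<alpha> - 1))"
  have der: "((\<lambda>s. y / (1 - s)) has_real_derivative y / (1 - s)\<^sup>2) (at s)" if "s \<in> {0<..<1 - y}" for s
    using that y by (auto intro!: derivative_eq_intros simp: power2_eq_square)
  have bij: "bij_betw (\<lambda>s. y / (1 - s)) {0<..<1 - y} {y / (1 - 0)<..<y / (1 - (1 - y))}"
  proof (rule bij_betw_open_interval_if_deriv_pos[OF _ _ der])
    show "continuous_on {0..1 - y} (\<lambda>s. y / (1 - s))"
      by (intro continuous_intros) (use y in auto)
  qed (use y in auto)
  then have bij: "bij_betw (\<lambda>s. y / (1 - s)) {0<..<1 - y} {y<..<1}"
    using y by simp
  have F: "?F s = \<bar>y / (1 - s)\<^sup>2\<bar> * ?f (y / (1 - s))" if s: "s \<in> {0<..<1 - y}" for s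
  proof -
    have eq: "y / (1 - s) - y = y * s / (1 - s)"
      using s y by (simp add: field_simps)
    have "ln (?F s) = ln (\<bar>y / (1 - s)\<^sup>2\<bar> * ?f (y / (1 - s)))"
      unfolding eq using s y
      by (simp add: ln_mult ln_div ln_realpow) (simp add: algebra_simps)
    then show ?thesis unfolding eq using s y by (subst (asm) ln_inj_iff) auto
  qed
  show ?thesis
    using set_lborel_change_of_variables(2)[where f="?f" and F="?F", OF _ _ _ _ der bij F]
    by (simp add: incomplete_beta_def)
qed

lemma set_integrable_green_odd_kernel:
  assumes "x \<in> {0<..<1}" "y \<in> {0<..<1}" "x \<noteq> y"
  shows "set_integrable lborel {0<..<1} (\<lambda>z. green \<alpha> z y * odd_kernel \<alpha> (x - z))"
proof -
  let ?C = "(y * (1 - y)) powr \<alpha> / (\<alpha> * (Gamma \<alpha>)\<^sup>2)"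
  have int: "set_integrable lborel {0<..<1}
      (\<lambda>z. ?C * (\<bar>y - z\<bar> powr (\<alpha> - 1) * \<bar>x - z\<bar> powr (- 2 * \<alpha>)))"
    by (intro set_integrable_mult_right set_integrable_subset[OF set_integrable_two_singularities])
       (use assms \<alpha> in auto)
  have bound: "norm (green \<alpha> z y * odd_kernel \<alpha> (x - z))
      \<le> norm (?C * (\<bar>y - z\<bar> powr (\<alpha> - 1) * \<bar>x - z\<bar> powr (- 2 * \<alpha>)))" for z
    \<comment> \<open>By symmetry \<open>green_le\<close> is applied with y as its first argument,
      so that the prefactor does not depend on z.\<close>
    using mult_right_mono[OF green_le[OF \<alpha>, of y z], of "\<bar>x - z\<bar> powr (- 2 * \<alpha>)"]
      green_nonneg[OF \<alpha>, of y z] assms \<alpha>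
    by (simp add: abs_mult abs_odd_kernel green_commute[OF \<alpha>, of z y] mult.assoc)
  show ?thesis
  proof (rule set_integrable_bound[OF int])
    show "set_borel_measurable lborel {0<..<1} (\<lambda>z. green \<alpha> z y * odd_kernel \<alpha> (x - z))"
      unfolding set_borel_measurable_def using borel_measurable_green'[OF \<alpha>, measurable (raw)] by measurable
  qed (intro AE_I2 impI bound)
qed

lemma set_integral_green_odd_kernel_less:
  assumes xy: "0 < x" "x < y" "y < 1"
  shows "(LINT z:{0<..<1}|lborel. green \<alpha> z y * odd_kernel \<alpha> (x - z)) =
    - (Beta \<alpha> (1 - \<alpha>) / (Gamma \<alpha>)\<^sup>2) * incomplete_beta \<alpha> (1 - y)"
proof -
  note [measurable] = borel_measurable_green'[OF \<alpha>]
  define w where "w t z = (t - z) powr (\<alpha> - 1) * (t - y) powr (\<alpha> - 1) / t powr (2 * \<alpha>)" for t z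
  have [measurable]: "(\<lambda>(z, t). w t z) \<in> borel_measurable (borel \<Otimes>\<^sub>M borel)"
    "w t \<in> borel_measurable borel" "(\<lambda>t. w t z) \<in> borel_measurable borel" for t z
    unfolding w_def by measurable
  \<comment> \<open>The conditions on z and t say that t runs from max z y to 1. Integrating over t
    first gives \<open>green\<close>, integrating over z first gives the Abel integral.\<close>
  define \<Phi> where "\<Phi> z t = (if 0 < z \<and> z < t \<and> y < t \<and> t < 1
      then z powr \<alpha> * y powr \<alpha> * w t z * odd_kernel \<alpha> (x - z) else 0)" for z t
  have [measurable]: "(\<lambda>(z, t). \<Phi> z t) \<in> borel_measurable (lborel \<Otimes>\<^sub>M lborel)"
    unfolding \<Phi>_def by measurable
  have G: "(\<integral>t. indicator {max z y<..<1} t * w t z \<partial>lborel)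
      = (Gamma \<alpha>)\<^sup>2 * green \<alpha> z y / (z powr \<alpha> * y powr \<alpha>)" if "z \<in> {0<..<1}" "z \<noteq> y" for z
  proof -
    have "(\<integral>t. indicator {max z y<..<1} t * w t z \<partial>lborel) = (LINT t:{max z y<..<1}|lborel. w t z)"
      by (simp add: set_lebesgue_integral_def)
    also have "\<dots> = (LINT t:{max z y..1}|lborel. w t z)"
      by (rule set_integral_discrete_difference[of "{max z y, 1}"]) auto
    finally show ?thesis
      using that xy \<alpha> Gamma_real_pos[of \<alpha>, THEN less_imp_neq] by (simp add: green_def w_def)
  qed
  have \<Phi>t: "\<Phi> z t = indicator {0<..<1} z * (z powr \<alpha> * y powr \<alpha> * odd_kernel \<alpha> (x - z)) *
      (indicator {max z y<..<1} t * w t z)" for z t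
    by (auto simp: \<Phi>_def indicator_def)
  have inner: "(\<integral>t. \<Phi> z t \<partial>lborel) = indicator {0<..<1} z * ((Gamma \<alpha>)\<^sup>2 * (green \<alpha> z y * odd_kernel \<alpha> (x - z)))"
    if "z \<noteq> y" for z
    using G[of z] that xy by (auto simp: \<Phi>t indicator_def)
  \<comment> \<open>\<open>w\<close> is nonnegative, so the absolute value reaches only the odd
    kernel. The absolute convergence needed for Fubini is thus that of
    \<open>set_integrable_green_odd_kernel\<close>.\<close>
  have inner_abs: "(\<integral>t. norm (\<Phi> z t) \<partial>lborel) =
       indicator {0<..<1} z * ((Gamma \<alpha>)\<^sup>2 * \<bar>green \<alpha> z y * odd_kernel \<alpha> (x - z)\<bar>)"
    if "z \<noteq> y" for z
  proof -
    have "norm (\<Phi> z t) = indicator {0<..<1} z * (z powr \<alpha> * y powr \<alpha> * \<bar>odd_kernel \<alpha> (x - z)\<bar>) *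
      (indicator {max z y<..<1} t * w t z)" for t
      by (auto simp: \<Phi>_def indicator_def abs_mult w_def)
    then show ?thesis
      using G[of z] that xy green_nonneg[OF \<alpha>, of z y] by (auto simp: indicator_def abs_mult)
  qed
  have int: "set_integrable lborel {0<..<1} (\<lambda>z. green \<alpha> z y * odd_kernel \<alpha> (x - z))"
    by (rule set_integrable_green_odd_kernel) (use xy in auto)
  \<comment> \<open>On the diagonal z = y the function \<open>green\<close> has its default value 0,
    while the t-integral diverges; this null set is left out.\<close>
  have ne: "AE z in lborel. z \<noteq> y"
    by (rule AE_lborel_singleton)
  have integrable: "integrable (lborel \<Otimes>\<^sub>M lborel) (\<lambda>(z, t). \<Phi> z t)"
  proof (rule lborel_pair.Fubini_integrable)
    have "integrable lborel (\<lambda>z. indicator {0<..<1} z * ((Gamma \<alpha>)\<^sup>2 * \<bar>green \<alpha> z y * odd_kernel \<alpha> (x - z)\<bar>))"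
      using set_integrable_mult_right[OF set_integrable_abs[OF int], of "(Gamma \<alpha>)\<^sup>2"]
      by (simp add: set_integrable_def)
    then show "integrable lborel (\<lambda>z. \<integral>t. norm (case (z, t) of (z, t) \<Rightarrow> \<Phi> z t) \<partial>lborel)"
      by (rule integrable_cong_AE_imp) (use ne inner_abs in auto)
    show "AE z in lborel. integrable lborel (\<lambda>t. case (z, t) of (z, t) \<Rightarrow> \<Phi> z t)"
      using ne
    proof eventually_elim
      case (elim z)
      show ?case
      proof (cases "z \<in> {0<..<1}")
        case True
        then have "integrable lborel (\<lambda>t. indicator {max z y<..<1} t * w t z)"
          using set_integrable_green[OF \<alpha>, of z y] xy elim by (simp add: set_integrable_def w_def)
        then show ?thesis by (simp add: \<Phi>t)
      qed (simp add: \<Phi>t)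
    qed
  qed simp
  \<comment> \<open>Every t in the range exceeds y and hence x, so the Abel integral applies and
    gives the same constant for all t.\<close>
  have outer: "(\<integral>z. \<Phi> z t \<partial>lborel) = - Beta \<alpha> (1 - \<alpha>) * y powr \<alpha> *
      (indicator {y<..<1} t * ((t - y) powr (\<alpha> - 1) / t powr (2 * \<alpha>)))" for t
  proof (cases "t \<in> {y<..<1}")
    case True
    have "\<Phi> z t = (y powr \<alpha> * ((t - y) powr (\<alpha> - 1) / t powr (2 * \<alpha>))) *
        (indicator {0<..<t} z * (z powr \<alpha> * (t - z) powr (\<alpha> - 1) * odd_kernel \<alpha> (x - z)))" for z
      using True by (auto simp: \<Phi>_def w_def indicator_def)
    then show ?thesis
      using True set_integral_abel_odd_kernel[OF \<alpha>, of x t] xy by (simp add: set_lebesgue_integral_def)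
  qed (auto simp: \<Phi>_def)
  have "(Gamma \<alpha>)\<^sup>2 * (LINT z:{0<..<1}|lborel. green \<alpha> z y * odd_kernel \<alpha> (x - z)) =
      (\<integral>z. indicator {0<..<1} z * ((Gamma \<alpha>)\<^sup>2 * (green \<alpha> z y * odd_kernel \<alpha> (x - z))) \<partial>lborel)"
    unfolding set_lebesgue_integral_def
    by (subst integral_mult_right_zero[symmetric]) (simp add: mult.left_commute)
  also have "\<dots> = (\<integral>z. \<integral>t. \<Phi> z t \<partial>lborel \<partial>lborel)"
    by (rule integral_cong_AE) (use ne inner in auto)
  also have "\<dots> = (\<integral>t. \<integral>z. \<Phi> z t \<partial>lborel \<partial>lborel)"
    using lborel_pair.Fubini_integral[of \<Phi>] integrable by simp
  also have "\<dots> = - Beta \<alpha> (1 - \<alpha>) * y powr \<alpha> * (LINT t:{y<..<1}|lborel. (t - y) powr (\<alpha> - 1) / t powr (2 * \<alpha>))"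
    unfolding outer set_lebesgue_integral_def real_scaleR_def by (rule integral_mult_right_zero)
  also have "\<dots> = - Beta \<alpha> (1 - \<alpha>) * incomplete_beta \<alpha> (1 - y)"
    using xy by (simp add: set_integral_green_tail powr_minus)
  finally show ?thesis
    using Gamma_real_pos[of \<alpha>, THEN less_imp_neq] \<alpha> by (simp add: field_simps)
qed

text \<open>Written so that x enters only through the side of y on which it lies. Reflection at 1/2
  gives the case y < x with a change of sign, since the kernel is odd. The height of the step at y =
  x is the full beta integral.\<close>

lemma set_integral_green_odd_kernel:
  assumes "x \<in> {0<..<1}" "y \<in> {0<..<1}" "x \<noteq> y"
  shows "(LINT z:{0<..<1}|lborel. green \<alpha> z y * odd_kernel \<alpha> (x - z)) =
    Beta \<alpha> (1 - \<alpha>) / (Gamma \<alpha>)\<^sup>2 * ((if y < x then Beta \<alpha> \<alpha> else 0) - incomplete_beta \<alpha> (1 - y))"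
proof (cases "x < y")
  case True
  then show ?thesis using assms set_integral_green_odd_kernel_less[of x y] by simp
next
  case False
  note [measurable] = borel_measurable_green'[OF \<alpha>]
  let ?f = "\<lambda>z. green \<alpha> z y * odd_kernel \<alpha> (x - z)"
  let ?F = "\<lambda>z. - 1 * (green \<alpha> z (1 - y) * odd_kernel \<alpha> ((1 - x) - z))"
  have bij: "bij_betw (\<lambda>s. 1 - s) {0<..<1::real} {0<..<1}"
    by (rule bij_betwI[where g="\<lambda>s. 1 - s"]) auto
  have der: "((\<lambda>s. 1 - s) has_real_derivative - 1) (at s)" for s
    by (auto intro!: derivative_eq_intros)
  have F: "?F z = \<bar>- 1\<bar> * ?f (1 - z)" for z
    using green_reflect[OF \<alpha>, of "1 - z" y] odd_kernel_minus[of \<alpha> "(1 - x) - z"]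
    by (simp add: algebra_simps)
  have "(LINT z:{0<..<1}|lborel. ?f z) = (LINT z:{0<..<1}|lborel. ?F z)"
    using set_lborel_change_of_variables(2)[where f="?f" and F="?F", OF _ _ _ _ der bij F] by simp
  also have "\<dots> = Beta \<alpha> (1 - \<alpha>) / (Gamma \<alpha>)\<^sup>2 * incomplete_beta \<alpha> y"
    unfolding set_integral_mult_right
    using set_integral_green_odd_kernel_less[of "1 - x" "1 - y"] assms False by simp
  also have "incomplete_beta \<alpha> y = Beta \<alpha> \<alpha> - incomplete_beta \<alpha> (1 - y)"
    using incomplete_beta_reflect[of y] assms by simp
  finally show ?thesis using assms False by simp
qed

end

section \<open>Differentiating the odd potential\<close>

text \<open>The cut-off integrands are dominated by the full one and converge to it at every y other
  than x.\<close>

lemma has_principal_value_if_integrable: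
  assumes int: "set_integrable lborel S f" and [measurable]: "S \<in> sets borel"
  shows "has_principal_value f x S (LINT y:S|lborel. f y)"
  unfolding has_principal_value_def
proof (intro conjI allI impI)
  show "set_integrable lborel {y \<in> S. \<epsilon> \<le> \<bar>x - y\<bar>} f" for \<epsilon>
    by (rule set_integrable_subset[OF int]) auto
  show "((\<lambda>\<epsilon>. LINT y:{y \<in> S. \<epsilon> \<le> \<bar>x - y\<bar>}|lborel. f y) \<longlongrightarrow> (LINT y:S|lborel. f y)) (at_right 0)"
  proof (rule tendsto_at_right_sequentially[of 0 1])
    fix e :: "nat \<Rightarrow> real" assume e: "\<And>n. 0 < e n" "e \<longlonglongrightarrow> 0"
    show "(\<lambda>n. LINT y:{y \<in> S. e n \<le> \<bar>x - y\<bar>}|lborel. f y) \<longlonglongrightarrow> (LINT y:S|lborel. f y)"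
      unfolding set_lebesgue_integral_def
    proof (rule integral_dominated_convergence)
      show meas: "(\<lambda>y. indicator S y *\<^sub>R f y) \<in> borel_measurable lborel"
        using int by (simp add: set_integrable_def)
      have m: "(\<lambda>y. indicator {y. e n \<le> \<bar>x - y\<bar>} y *\<^sub>R (indicator S y *\<^sub>R f y)) \<in> borel_measurable lborel" for n
        by (intro borel_measurable_scaleR meas) auto
      have eq: "indicator {y. e n \<le> \<bar>x - y\<bar>} y *\<^sub>R (indicator S y *\<^sub>R f y)
          = indicator {y \<in> S. e n \<le> \<bar>x - y\<bar>} y *\<^sub>R f y" for n y
        by (auto simp: indicator_def)
      show "(\<lambda>y. indicator {y \<in> S. e n \<le> \<bar>x - y\<bar>} y *\<^sub>R f y) \<in> borel_measurable lborel" for n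
        using m[of n] by (simp only: eq)
      show "integrable lborel (\<lambda>y. norm (indicator S y *\<^sub>R f y))"
        using int by (auto simp: set_integrable_def simp del: real_scaleR_def)
      show "AE y in lborel. (\<lambda>n. indicator {y \<in> S. e n \<le> \<bar>x - y\<bar>} y *\<^sub>R f y) \<longlonglongrightarrow> indicator S y *\<^sub>R f y"
        using AE_lborel_singleton[of x]
      proof eventually_elim
        case (elim y)
        then have "eventually (\<lambda>n. e n < \<bar>x - y\<bar>) sequentially"
          by (intro order_tendstoD(2)[OF e(2)]) simp
        then have "eventually (\<lambda>n. indicator {y \<in> S. e n \<le> \<bar>x - y\<bar>} y *\<^sub>R f y = indicator S y *\<^sub>R f y) sequentially"
          by eventually_elim (auto simp: indicator_def)
        then show ?case by (rule tendsto_eventually)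
      qed
    qed (auto simp: indicator_def)
  qed simp
qed

context
  fixes \<alpha> :: real
  assumes \<alpha>: "0 < \<alpha>" "\<alpha> < 1 / 2"
begin

private lemma expo: "- 1 - 2 * \<alpha> = - (2 * \<alpha>) - 1"
  by simp

lemma powr_diff_le:
  assumes "0 < v" "0 \<le> \<eta>"
  shows "\<bar>(v + \<eta>) powr (- 2 * \<alpha>) - v powr (- 2 * \<alpha>)\<bar> \<le> 2 * \<alpha> * v powr (- 1 - 2 * \<alpha>) * \<eta>"
proof (cases "\<eta> = 0")
  case False
  have "\<exists>z. v < z \<and> z < v + \<eta> \<and> (v + \<eta>) powr (- 2 * \<alpha>) - v powr (- 2 * \<alpha>)
      = (v + \<eta> - v) * (- 2 * \<alpha> * z powr (- 2 * \<alpha> - 1))"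
    by (rule MVT2) (use assms False in \<open>auto intro!: derivative_eq_intros\<close>)
  then obtain z where z: "v < z" "(v + \<eta>) powr (- 2 * \<alpha>) - v powr (- 2 * \<alpha>)
      = \<eta> * (- 2 * \<alpha> * z powr (- 2 * \<alpha> - 1))" by auto
  have "z powr (- 2 * \<alpha> - 1) \<le> v powr (- 2 * \<alpha> - 1)"
    using z(1) assms \<alpha> by (intro powr_mono2') auto
  then have "\<eta> * (2 * \<alpha>) * z powr (- 2 * \<alpha> - 1) \<le> \<eta> * (2 * \<alpha>) * v powr (- 2 * \<alpha> - 1)"
    using assms \<alpha> by (intro mult_left_mono) auto
  then show ?thesis
    unfolding z(2) expo using assms \<alpha> by (simp add: abs_mult mult_ac)
qed simp

text \<open>The condition on \<eta> keeps s and s + \<eta> on the same side of 0, both at distance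
  at least |s| / 2 from it, so the mean value theorem applies without meeting the
  singularity.\<close>

lemma odd_kernel_diff_le:
  assumes "0 < \<eta>" "2 * \<eta> \<le> \<bar>s\<bar>"
  shows "\<bar>odd_kernel \<alpha> (s + \<eta>) - odd_kernel \<alpha> s\<bar> \<le> 2 * \<alpha> * (\<bar>s\<bar> / 2) powr (- 1 - 2 * \<alpha>) * \<eta>"
proof -
  have mono: "2 * \<alpha> * v powr (- 1 - 2 * \<alpha>) * \<eta> \<le> 2 * \<alpha> * (\<bar>s\<bar> / 2) powr (- 1 - 2 * \<alpha>) * \<eta>"
    if "\<bar>s\<bar> / 2 \<le> v" for v
    using that assms \<alpha> by (intro mult_right_mono mult_left_mono powr_mono2') auto
  show ?thesis
  proof (cases "0 < s")
    case True
    then show ?thesis using powr_diff_le[of s \<eta>] mono[of s] assms by (simp add: odd_kernel_def)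
  next
    case False
    then have "s + \<eta> < 0" using assms by auto
    then show ?thesis
      using powr_diff_le[of "- s - \<eta>" \<eta>] mono[of "- s - \<eta>"] False assms
      by (simp add: odd_kernel_def)
  qed
qed

lemma DERIV_odd_kernel:
  assumes "s \<noteq> 0"
  shows "(odd_kernel \<alpha> has_real_derivative - 2 * \<alpha> * \<bar>s\<bar> powr (- 1 - 2 * \<alpha>)) (at s)"
proof (cases "0 < s")
  case True
  have "((\<lambda>s. s powr (- 2 * \<alpha>)) has_real_derivative - 2 * \<alpha> * \<bar>s\<bar> powr (- 1 - 2 * \<alpha>)) (at s)"
    using True by (auto intro!: derivative_eq_intros simp: expo)
  then show ?thesis
    by (rule has_field_derivative_transform_within_open[where S="{0<..}"])
       (use True in \<open>auto simp: odd_kernel_def\<close>)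
next
  case False
  then have "((\<lambda>s. - ((- s) powr (- 2 * \<alpha>))) has_real_derivative - 2 * \<alpha> * \<bar>s\<bar> powr (- 1 - 2 * \<alpha>)) (at s)"
    using assms by (auto intro!: derivative_eq_intros simp: expo)
  then show ?thesis
    by (rule has_field_derivative_transform_within_open[where S="{..<0}"])
       (use False assms in \<open>auto simp: odd_kernel_def\<close>)
qed

lemma set_integrable_odd_kernel:
  assumes "x \<in> {0..1}"
  shows "set_integrable lborel {0<..<1} (\<lambda>z. odd_kernel \<alpha> (x - z))"
proof -
  have "set_integrable lborel {0<..<1} (\<lambda>z. \<bar>x - z\<bar> powr (- 2 * \<alpha>))"
    by (rule set_integrable_subset[OF set_integrable_abs_powr_unit]) (use assms \<alpha> in auto)
  then show ?thesis
    by (rule set_integrable_bound) (auto simp: set_borel_measurable_def abs_odd_kernel)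
qed

text \<open>The potential of the constant 1. Its derivative in s is s^(-2\<alpha>) + (1 -
  s)^(-2\<alpha>), the boundary term of the fractional Laplacian.\<close>

lemma set_integral_odd_kernel:
  assumes "s \<in> {0<..<1}"
  shows "(LINT z:{0<..<1}|lborel. odd_kernel \<alpha> (s - z)) =
     (s powr (1 - 2 * \<alpha>) - (1 - s) powr (1 - 2 * \<alpha>)) / (1 - 2 * \<alpha>)"
proof -
  let ?k = "\<lambda>z. odd_kernel \<alpha> (s - z)" and ?g = "\<lambda>y::real. y powr (- 2 * \<alpha>)"
  have bij1: "bij_betw (\<lambda>z. s - z) {0<..<s} {0<..<s}"
    by (rule bij_betwI[where g="\<lambda>z. s - z"]) auto
  have bij2: "bij_betw (\<lambda>z. z - s) {s<..<1} {0<..<1-s}"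
    by (rule bij_betwI[where g="\<lambda>z. z + s"]) auto
  have der1: "((\<lambda>z. s - z) has_real_derivative -1) (at z)" for z
    by (auto intro!: derivative_eq_intros)
  have der2: "((\<lambda>z. z - s) has_real_derivative 1) (at z)" for z
    by (auto intro!: derivative_eq_intros)
  have P: "(LINT y:{0<..<r}|lborel. ?g y) = r powr (1 - 2 * \<alpha>) / (1 - 2 * \<alpha>)" if "0 \<le> r" for r
  proof -
    have "(LINT y:{0<..<r}|lborel. ?g y) = (LINT y:{0..r}|lborel. ?g y)"
      by (rule set_integral_discrete_difference[of "{0, r}"]) auto
    then show ?thesis
      using set_integral_powr_from_0[of "- 2 * \<alpha>" r] that \<alpha> by (simp add: algebra_simps)
  qed
  have "(LINT z:{0<..<s}|lborel. ?k z) = (LINT y:{0<..<s}|lborel. ?g y)"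
    by (rule set_lborel_change_of_variables(2)[OF _ _ _ _ der1 bij1, symmetric])
       (auto simp: odd_kernel_def)
  then have 1: "(LINT z:{0<..<s}|lborel. ?k z) = s powr (1 - 2 * \<alpha>) / (1 - 2 * \<alpha>)"
    using P[of s] assms by simp
  have "(LINT z:{s<..<1}|lborel. - 1 * ?k z) = (LINT y:{0<..<1 - s}|lborel. ?g y)"
    by (rule set_lborel_change_of_variables(2)[OF _ _ _ _ der2 bij2, symmetric])
       (auto simp: odd_kernel_def)
  then have 2: "(LINT z:{s<..<1}|lborel. ?k z) = - ((1 - s) powr (1 - 2 * \<alpha>) / (1 - 2 * \<alpha>))"
    using P[of "1 - s"] assms unfolding set_integral_mult_right by simp
  have int: "set_integrable lborel {0<..<1} ?k"
    using assms by (intro set_integrable_odd_kernel) auto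
  have "(LINT z:{0<..<1}|lborel. ?k z) = (LINT z:{0<..<s} \<union> {s<..<1}|lborel. ?k z)"
    by (rule set_integral_discrete_difference[of "{s}"]) (use assms in auto)
  also have "\<dots> = (LINT z:{0<..<s}|lborel. ?k z) + (LINT z:{s<..<1}|lborel. ?k z)"
    by (rule set_integral_Un) (use assms in \<open>auto intro: set_integrable_subset[OF int]\<close>)
  finally show ?thesis unfolding 1 2 by (simp add: diff_divide_distrib)
qed

text \<open>The difference quotients of the potential are dominated away from the singularity only;
  the part over \<open>\<bar>x - z\<bar> < 2 \<eta>\<close> is \<open>O(\<eta> powr (1 - 2 \<alpha>))\<close> because \<open>\<phi>\<close> is Lipschitz at \<open>x\<close>.\<close>
lemma DERIV_odd_kernel_potential:
  assumes x: "x \<in> {0<..<1}" and [measurable]: "\<phi> \<in> borel_measurable borel"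
    and lip: "\<And>z. z \<in> {0<..<1} \<Longrightarrow> \<bar>\<phi> z\<bar> \<le> K * \<bar>x - z\<bar>"
    and der: "((\<lambda>s. LINT z:{0<..<1}|lborel. \<phi> z * odd_kernel \<alpha> (s - z)) has_real_derivative D) (at x)"
  shows "D = (LINT z:{0<..<1}|lborel. \<phi> z * (- 2 * \<alpha> * \<bar>x - z\<bar> powr (- 1 - 2 * \<alpha>)))"
proof -
  let ?k = "odd_kernel \<alpha>" and ?I = "{0<..<1::real}"
  \<comment> \<open>The derivative is known to exist, so a single sequence of increments determines
    \<open>D\<close>. The factor (1 - x) / 2 keeps x + \<eta> n inside the unit interval.\<close>
  define \<eta> where "\<eta> n = (1 - x) / 2 / Suc n" for n :: nat
  have \<eta>: "0 < \<eta> n" "\<eta> n < 1 - x" for n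
  proof -
    show "0 < \<eta> n" using x by (simp add: \<eta>_def)
    have "\<eta> n \<le> (1 - x) / 2 / 1"
      unfolding \<eta>_def using x by (intro divide_left_mono) auto
    then show "\<eta> n < 1 - x" using x by simp
  qed
  have \<eta>0: "\<eta> \<longlonglongrightarrow> 0"
    unfolding \<eta>_def by (rule LIMSEQ_Suc) (rule lim_const_over_n)
  have K: "0 \<le> K"
    using lip[of "x / 2"] x by (smt (verit) greaterThanLessThan_iff field_sum_of_halves mult_neg_pos abs_ge_zero)
  have int: "set_integrable lborel ?I (\<lambda>z. \<phi> z * ?k (s - z))" if "s \<in> {0..1}" for s
  proof (rule set_integrable_bound)
    show "set_integrable lborel ?I (\<lambda>z. K * ?k (s - z))"
      by (intro set_integrable_mult_right set_integrable_odd_kernel that)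
    show "AE z in lborel. z \<in> ?I \<longrightarrow> norm (\<phi> z * ?k (s - z)) \<le> norm (K * ?k (s - z))"
    proof (intro AE_I2 impI)
      fix z :: real assume z: "z \<in> ?I"
      have "K * \<bar>x - z\<bar> \<le> K * 1" using K z x by (intro mult_left_mono) auto
      then have "\<bar>\<phi> z\<bar> \<le> K" using lip[OF z] by simp
      then show "norm (\<phi> z * ?k (s - z)) \<le> norm (K * ?k (s - z))"
        using K by (simp add: abs_mult mult_right_mono)
    qed
  qed (simp add: set_borel_measurable_def)
  define q where "q n z = \<phi> z * ((?k (x + \<eta> n - z) - ?k (x - z)) / \<eta> n)" for n z
  have [measurable]: "q n \<in> borel_measurable borel" for n
    unfolding q_def by measurable
  have int_q: "set_integrable lborel ?I (q n)" for n
    unfolding q_def right_diff_distrib diff_divide_distrib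
    using set_integral_diff(1)[OF int[of "x + \<eta> n"] int[of x]] x \<eta>[of n]
    by (auto simp: set_integrable_def add_divide_distrib right_diff_distrib diff_divide_distrib
        dest: integrable_divide[of _ _ "\<eta> n"])
  have q: "(LINT z:?I|lborel. q n z) = ((LINT z:?I|lborel. \<phi> z * ?k (x + \<eta> n - z)) -
      (LINT z:?I|lborel. \<phi> z * ?k (x - z))) / \<eta> n" for n
  proof -
    have "(LINT z:?I|lborel. q n z)
      = (LINT z:?I|lborel. (\<phi> z * ?k (x + \<eta> n - z) - \<phi> z * ?k (x - z)) / \<eta> n)"
      by (simp add: q_def right_diff_distrib)
    also have "\<dots> = (LINT z:?I|lborel. (\<phi> z * ?k (x + \<eta> n - z) - \<phi> z * ?k (x - z))) / \<eta> n"
      by (rule set_integral_divide_zero)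
    finally show ?thesis
      using int[of "x + \<eta> n"] int[of x] x \<eta>[of n] by (subst (asm) set_integral_diff) auto
  qed
  have lim_D: "(\<lambda>n. LINT z:?I|lborel. q n z) \<longlonglongrightarrow> D"
  proof -
    have "filterlim \<eta> (at 0) sequentially"
      using \<eta>0 \<eta>(1) by (intro filterlim_atI) (auto intro!: always_eventually simp: less_imp_neq[symmetric])
    from filterlim_compose[OF der[unfolded DERIV_def] this] show ?thesis
      by (simp add: q)
  qed
  \<comment> \<open>The threshold 2 \<eta> n is the one under which
    \<open>odd_kernel_diff_le\<close> controls the difference quotient on
    \<open>F n\<close>.\<close>
  define N where "N n = {z \<in> ?I. \<bar>x - z\<bar> < 2 * \<eta> n}" for n
  define F where "F n = {z \<in> ?I. 2 * \<eta> n \<le> \<bar>x - z\<bar>}" for n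
  have [measurable]: "N n \<in> sets borel" "F n \<in> sets borel" for n
    unfolding N_def F_def by measurable
  have NF: "N n \<union> F n = ?I" "N n \<inter> F n = {}" for n
    unfolding N_def F_def by auto
  have near: "(\<lambda>n. LINT z:N n|lborel. q n z) \<longlonglongrightarrow> 0"
  proof -
    let ?P = "\<lambda>r. 2 * r powr (- 2 * \<alpha> + 1) / (- 2 * \<alpha> + 1)"
    have bound: "norm (LINT z:N n|lborel. q n z) \<le> 2 * K * (?P (3 * \<eta> n) + ?P (2 * \<eta> n))" for n
    proof -
      let ?a = "\<lambda>z. \<bar>(x + \<eta> n) - z\<bar> powr (- 2 * \<alpha>)" and ?b = "\<lambda>z. \<bar>x - z\<bar> powr (- 2 * \<alpha>)"
      \<comment> \<open>Both intervals contain \<open>N n\<close>. Each is centred at the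
        singularity of its own kernel, so both integrals are explicit; on \<open>N n\<close> the
        Lipschitz bound on \<phi> absorbs the division by \<eta> n.\<close>
      let ?A = "{x + \<eta> n - 3 * \<eta> n..x + \<eta> n + 3 * \<eta> n}" and ?B = "{x - 2 * \<eta> n..x + 2 * \<eta> n}"
      have ia: "integrable lborel (\<lambda>z. indicator ?A z * ?a z)"
        using set_integrable_abs_powr[of "- 2 * \<alpha>" "3 * \<eta> n" "x + \<eta> n"] \<alpha> \<eta>(1)[of n]
        by (simp add: set_integrable_def)
      have ib: "integrable lborel (\<lambda>z. indicator ?B z * ?b z)"
        using set_integrable_abs_powr[of "- 2 * \<alpha>" "2 * \<eta> n" "x"] \<alpha> \<eta>(1)[of n]
        by (simp add: set_integrable_def)
      have le: "norm (indicator (N n) z *\<^sub>R q n z) \<le>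
         2 * K * (indicator ?A z * ?a z + indicator ?B z * ?b z)" for z
      proof (cases "z \<in> N n")
        case True
        then have z: "z \<in> ?I" "\<bar>x - z\<bar> < 2 * \<eta> n" by (auto simp: N_def)
        then have mem: "z \<in> ?A" "z \<in> ?B" using \<eta>(1)[of n] by auto
        have "\<bar>\<phi> z\<bar> / \<eta> n \<le> 2 * K"
          using lip[OF z(1)] mult_left_mono[OF less_imp_le[OF z(2)] K] \<eta>(1)[of n]
          by (simp add: pos_divide_le_eq mult_ac)
        moreover have "\<bar>?k (x + \<eta> n - z) - ?k (x - z)\<bar> \<le> ?a z + ?b z"
          using abs_triangle_ineq4[of "?k (x + \<eta> n - z)" "?k (x - z)"] by (simp add: abs_odd_kernel)
        ultimately have "\<bar>\<phi> z\<bar> / \<eta> n * \<bar>?k (x + \<eta> n - z) - ?k (x - z)\<bar> \<le> 2 * K * (?a z + ?b z)"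
          using K \<eta>(1)[of n] by (intro mult_mono) auto
        then show ?thesis
          using True mem \<eta>(1)[of n] by (simp add: q_def abs_mult)
      qed (use K in simp)
      have "norm (LINT z:N n|lborel. q n z) \<le>
          (\<integral>z. 2 * K * (indicator ?A z * ?a z + indicator ?B z * ?b z) \<partial>lborel)"
        unfolding set_lebesgue_integral_def
        by (rule Bochner_Integration.integral_norm_bound_integral)
           (use ia ib le int_q[of n, THEN set_integrable_subset, of "N n"] NF in
            \<open>auto simp: set_integrable_def simp del: real_norm_def\<close>)
      also have "\<dots> = 2 * K * (?P (3 * \<eta> n) + ?P (2 * \<eta> n))"
        using ia ib set_integral_abs_powr[of "- 2 * \<alpha>" "2 * \<eta> n" "x"]
          set_integral_abs_powr[of "- 2 * \<alpha>" "3 * \<eta> n" "x + \<eta> n"] \<alpha> \<eta>(1)[of n]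
        by (simp add: set_lebesgue_integral_def)
      finally show ?thesis .
    qed
    have "(\<lambda>n. 2 * K * (?P (3 * \<eta> n) + ?P (2 * \<eta> n))) \<longlonglongrightarrow> 2 * K * (?P (3 * 0) + ?P (2 * 0))"
      using \<alpha> \<eta>(1) by (intro tendsto_intros tendsto_powr' \<eta>0) (auto simp: less_imp_le)
    then have "(\<lambda>n. 2 * K * (?P (3 * \<eta> n) + ?P (2 * \<eta> n))) \<longlonglongrightarrow> 0"
      by simp
    then show ?thesis
      by (rule Lim_null_comparison[OF always_eventually[OF allI[OF bound]]])
  qed
  have far: "(\<lambda>n. LINT z:F n|lborel. q n z) \<longlonglongrightarrow>
      (LINT z:?I|lborel. \<phi> z * (- 2 * \<alpha> * \<bar>x - z\<bar> powr (- 1 - 2 * \<alpha>)))"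
    unfolding set_lebesgue_integral_def
  proof (rule integral_dominated_convergence)
    \<comment> \<open>The quotient of the kernels is of order |x - z|^(-1-2\<alpha>) on
      \<open>F n\<close>, with the factor 1/2 coming from \<open>odd_kernel_diff_le\<close>. The
      Lipschitz bound supplies one power of |x - z|, and what is left is integrable.\<close>
    let ?w = "\<lambda>z. K * (2 * \<alpha> * (1 / 2) powr (- 1 - 2 * \<alpha>)) * \<bar>x - z\<bar> powr (- 2 * \<alpha>)"
    have "set_integrable lborel {0..1} ?w"
      using x \<alpha> by (intro set_integrable_mult_right set_integrable_abs_powr_unit) auto
    then show "integrable lborel (\<lambda>z. indicator {0..1} z * ?w z)"
      by (simp add: set_integrable_def)
    show "AE z in lborel. norm (indicator (F n) z *\<^sub>R q n z) \<le> indicator {0..1} z * ?w z" for n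
    proof (intro AE_I2)
      fix z
      show "norm (indicator (F n) z *\<^sub>R q n z) \<le> indicator {0..1} z * ?w z"
      proof (cases "z \<in> F n")
        case True
        then have z: "z \<in> ?I" "2 * \<eta> n \<le> \<bar>x - z\<bar>" by (auto simp: F_def)
        have "\<bar>?k (x - z + \<eta> n) - ?k (x - z)\<bar> / \<eta> n \<le> 2 * \<alpha> * (\<bar>x - z\<bar> / 2) powr (- 1 - 2 * \<alpha>)"
          using odd_kernel_diff_le[OF \<eta>(1) z(2)] \<eta>(1)[of n] by (simp add: pos_divide_le_eq)
        then have "\<bar>\<phi> z\<bar> * (\<bar>?k (x - z + \<eta> n) - ?k (x - z)\<bar> / \<eta> n) \<le>
            K * \<bar>x - z\<bar> * (2 * \<alpha> * (\<bar>x - z\<bar> / 2) powr (- 1 - 2 * \<alpha>))"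
          using lip[OF z(1)] K \<eta>(1)[of n] by (intro mult_mono) auto
        also have "\<dots> = K * (2 * \<alpha> * (1 / 2) powr (- 1 - 2 * \<alpha>)) * (\<bar>x - z\<bar> * \<bar>x - z\<bar> powr (- 1 - 2 * \<alpha>))"
          using powr_mult[of "1 / 2" "\<bar>x - z\<bar>" "- 1 - 2 * \<alpha>"] by simp
        also have "\<bar>x - z\<bar> * \<bar>x - z\<bar> powr (- 1 - 2 * \<alpha>) = \<bar>x - z\<bar> powr (- 2 * \<alpha>)"
          using powr_mult_base[of "\<bar>x - z\<bar>" "- 1 - 2 * \<alpha>"] z \<eta>(1)[of n] by simp
        finally show ?thesis
          using True z(1) \<eta>(1)[of n] by (simp add: q_def abs_mult add_diff_eq diff_add_eq)
      qed (use K \<alpha> in \<open>simp add: zero_le_mult_iff\<close>)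
    qed
    show "AE z in lborel. (\<lambda>n. indicator (F n) z *\<^sub>R q n z) \<longlonglongrightarrow>
        indicator ?I z *\<^sub>R (\<phi> z * (- 2 * \<alpha> * \<bar>x - z\<bar> powr (- 1 - 2 * \<alpha>)))"
      using AE_lborel_singleton[of x]
    proof eventually_elim
      case (elim z)
      have "filterlim \<eta> (at 0) sequentially"
        using \<eta>0 \<eta>(1) by (intro filterlim_atI) (auto intro!: always_eventually simp: less_imp_neq[symmetric])
      from filterlim_compose[OF DERIV_odd_kernel[of "x - z", unfolded DERIV_def] this]
      have "(\<lambda>n. (?k (x + \<eta> n - z) - ?k (x - z)) / \<eta> n) \<longlonglongrightarrow> - 2 * \<alpha> * \<bar>x - z\<bar> powr (- 1 - 2 * \<alpha>)"
        using elim by (simp add: diff_add_eq)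
      then have "(\<lambda>n. indicator ?I z * q n z) \<longlonglongrightarrow>
          indicator ?I z * (\<phi> z * (- 2 * \<alpha> * \<bar>x - z\<bar> powr (- 1 - 2 * \<alpha>)))"
        unfolding q_def by (intro tendsto_intros)
      moreover have "eventually (\<lambda>n. 2 * \<eta> n < \<bar>x - z\<bar>) sequentially"
        using order_tendstoD(2)[OF tendsto_mult_right_zero[OF \<eta>0, of 2], of "\<bar>x - z\<bar>"] elim by simp
      then have "eventually (\<lambda>n. indicator ?I z * q n z = indicator (F n) z *\<^sub>R q n z) sequentially"
        by eventually_elim (auto simp: F_def indicator_def)
      ultimately show ?case
        by (simp add: Lim_transform_eventually)
    qed
  qed auto
  have "(LINT z:?I|lborel. q n z) = (LINT z:N n|lborel. q n z) + (LINT z:F n|lborel. q n z)" for n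
    unfolding NF(1)[of n, symmetric]
    by (intro set_integral_Un set_integrable_subset[OF int_q]) (use NF[of n] in auto)
  with lim_D have "(\<lambda>n. (LINT z:N n|lborel. q n z) + (LINT z:F n|lborel. q n z)) \<longlonglongrightarrow> D"
    by simp
  from LIMSEQ_unique[OF this tendsto_add[OF near far]] show ?thesis by simp
qed

text \<open>Subtracting the constant \<open>u x\<close> gives a density that vanishes to first order
  at x, to which \<open>DERIV_odd_kernel_potential\<close> applies. The potential of that constant
  is explicit and produces the boundary weights. The principal value is here an absolutely
  convergent integral.\<close>

lemma has_frac_laplacian_if_potential:
  assumes x: "x \<in> {0<..<1}" and [measurable]: "u \<in> borel_measurable borel"
    and lip: "\<And>z. z \<in> {0<..<1} \<Longrightarrow> \<bar>u z - u x\<bar> \<le> K * \<bar>x - z\<bar>"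
    and der: "((\<lambda>s. LINT z:{0<..<1}|lborel. u z * odd_kernel \<alpha> (s - z)) has_real_derivative D) (at x)"
  shows "has_frac_laplacian \<alpha> u x (frac_lap_const \<alpha> * D / (2 * \<alpha>))"
proof -
  let ?k = "odd_kernel \<alpha>" and ?I = "{0<..<1::real}"
  let ?W = "x powr (- 2 * \<alpha>) + (1 - x) powr (- 2 * \<alpha>)"
  let ?f = "\<lambda>y. (u x - u y) / \<bar>x - y\<bar> powr (1 + 2 * \<alpha>)"
  have K: "0 \<le> K"
    using lip[of "x / 2"] x by (smt (verit) greaterThanLessThan_iff field_sum_of_halves mult_neg_pos abs_ge_zero)
  have int_f: "set_integrable lborel ?I ?f"
  proof (rule set_integrable_bound)
    show "set_integrable lborel ?I (\<lambda>z. K * \<bar>x - z\<bar> powr (- 2 * \<alpha>))"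
      by (intro set_integrable_mult_right set_integrable_subset[OF set_integrable_abs_powr_unit[of _ x]])
         (use x \<alpha> in auto)
    show "AE z in lborel. z \<in> ?I \<longrightarrow> norm (?f z) \<le> norm (K * \<bar>x - z\<bar> powr (- 2 * \<alpha>))"
    proof (intro AE_I2 impI)
      fix z :: real assume z: "z \<in> ?I"
      have "\<bar>u x - u z\<bar> \<le> K * \<bar>x - z\<bar> powr (- 2 * \<alpha>) * \<bar>x - z\<bar> powr (1 + 2 * \<alpha>)"
        using lip[OF z] powr_add[of "\<bar>x - z\<bar>" "- 2 * \<alpha>" "1 + 2 * \<alpha>"]
        by (cases "x = z") (simp_all add: abs_minus_commute mult.assoc)
      then show "norm (?f z) \<le> norm (K * \<bar>x - z\<bar> powr (- 2 * \<alpha>))"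
        using K by (cases "x = z") (auto simp: abs_mult pos_divide_le_eq)
    qed
  qed (simp add: set_borel_measurable_def)
  have pot_int: "set_integrable lborel ?I (\<lambda>z. (u z - u x) * ?k (s - z))" if "s \<in> ?I" for s
  proof (rule set_integrable_bound)
    show "set_integrable lborel ?I (\<lambda>z. K * ?k (s - z))"
      by (intro set_integrable_mult_right set_integrable_odd_kernel) (use that in auto)
    show "AE z in lborel. z \<in> ?I \<longrightarrow> norm ((u z - u x) * ?k (s - z)) \<le> norm (K * ?k (s - z))"
    proof (intro AE_I2 impI)
      fix z :: real assume z: "z \<in> ?I"
      have "K * \<bar>x - z\<bar> \<le> K * 1" using K z x by (intro mult_left_mono) auto
      then have "\<bar>u z - u x\<bar> \<le> K" using lip[OF z] by simp
      then show "norm ((u z - u x) * ?k (s - z)) \<le> norm (K * ?k (s - z))"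
        using K by (simp add: abs_mult mult_right_mono)
    qed
  qed (simp add: set_borel_measurable_def)
  have split: "(LINT z:?I|lborel. (u z - u x) * ?k (s - z)) = (LINT z:?I|lborel. u z * ?k (s - z)) -
      u x * ((s powr (1 - 2 * \<alpha>) - (1 - s) powr (1 - 2 * \<alpha>)) / (1 - 2 * \<alpha>))" if "s \<in> ?I" for s
  proof -
    have "set_integrable lborel ?I (\<lambda>z. u x * ?k (s - z))"
      by (intro set_integrable_mult_right set_integrable_odd_kernel) (use that in auto)
    from set_integral_add(2)[OF pot_int[OF that] this] show ?thesis
      unfolding set_integral_mult_right set_integral_odd_kernel[OF that] by (simp add: algebra_simps)
  qed
  have "((\<lambda>s. s powr (1 - 2 * \<alpha>) - (1 - s) powr (1 - 2 * \<alpha>)) has_real_derivative (1 - 2 * \<alpha>) * ?W) (at x)"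
    using x by (auto intro!: derivative_eq_intros simp: algebra_simps)
  from DERIV_cdivide[OF this, of "1 - 2 * \<alpha>"] \<alpha>
  have "((\<lambda>s. (s powr (1 - 2 * \<alpha>) - (1 - s) powr (1 - 2 * \<alpha>)) / (1 - 2 * \<alpha>)) has_real_derivative ?W) (at x)"
    by simp
  from DERIV_diff[OF der DERIV_cmult[OF this, of "u x"]]
  have "((\<lambda>s. (LINT z:?I|lborel. u z * ?k (s - z)) -
      u x * ((s powr (1 - 2 * \<alpha>) - (1 - s) powr (1 - 2 * \<alpha>)) / (1 - 2 * \<alpha>)))
      has_real_derivative D - u x * ?W) (at x)" .
  then have "((\<lambda>s. LINT z:?I|lborel. (u z - u x) * ?k (s - z)) has_real_derivative D - u x * ?W) (at x)"
    by (rule has_field_derivative_transform_within_open[where S="?I"]) (use x split in auto)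
  from DERIV_odd_kernel_potential[OF x _ _ this, of K] lip
  have "D - u x * ?W = (LINT z:?I|lborel. (u z - u x) * (- 2 * \<alpha> * \<bar>x - z\<bar> powr (- 1 - 2 * \<alpha>)))"
    by simp
  also have "\<dots> = (LINT z:?I|lborel. 2 * \<alpha> * ?f z)"
    using powr_minus_divide[of _ "1 + 2 * \<alpha>"]
    by (intro set_lebesgue_integral_cong) (auto simp: algebra_simps diff_divide_distrib)
  finally have "D - u x * ?W = 2 * \<alpha> * (LINT z:?I|lborel. ?f z)"
    by (simp only: set_integral_mult_right)
  then have "D / (2 * \<alpha>) = (LINT z:?I|lborel. ?f z) + u x / (2 * \<alpha>) * ?W"
    using \<alpha> by (simp add: field_simps)
  then have "frac_lap_const \<alpha> * D / (2 * \<alpha>) =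
      frac_lap_const \<alpha> * ((LINT z:?I|lborel. ?f z) + u x / (2 * \<alpha>) * ?W)"
    by (simp flip: times_divide_eq_right)
  with has_principal_value_if_integrable[OF int_f, of x] show ?thesis
    unfolding has_frac_laplacian_def by auto
qed

end

section \<open>Uniqueness and the potential of the Green solution\<close>

context
  fixes \<alpha> :: real
  assumes \<alpha>: "0 < \<alpha>" "\<alpha> < 1 / 2"
begin

section \<open>The normalising constant\<close>

private lemma minus_not_nonpos_Int: "- \<alpha> \<notin> \<int>\<^sub>\<le>\<^sub>0"
proof
  assume "- \<alpha> \<in> \<int>\<^sub>\<le>\<^sub>0"
  then obtain n where "- \<alpha> = of_int n" by (elim nonpos_Ints_cases)
  then have "of_int n < (0::real)" "-1 < (of_int n :: real)" using \<alpha> by linarith+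
  then have "n < 0" "-1 < n" by simp_all
  then show False by simp
qed

lemma frac_lap_const_pos: "0 < frac_lap_const \<alpha>"
proof -
  have "Gamma (- \<alpha>) \<noteq> 0"
    using minus_not_nonpos_Int by (simp add: Gamma_eq_zero_iff)
  then show ?thesis
    using \<alpha> by (auto simp: frac_lap_const_def intro!: divide_pos_pos mult_pos_pos Gamma_real_pos)
qed

text \<open>The factor of the constant is the jump height of the odd potential. By
  |Gamma(-\<alpha>)| = Gamma(1 - \<alpha>) / \<alpha> the factor Gamma(1 - \<alpha>) cancels, and
  the remaining quotient of Gamma(\<alpha>) Gamma(\<alpha> + 1/2) by Gamma(2\<alpha>) is given by
  duplication.\<close>

lemma frac_lap_const_Beta:
  "frac_lap_const \<alpha> * (Beta \<alpha> (1 - \<alpha>) / (Gamma \<alpha>)\<^sup>2 * Beta \<alpha> \<alpha>) = 2 * \<alpha>"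
proof -
  have pos: "0 < Gamma \<alpha>" "0 < Gamma (1 - \<alpha>)" "0 < Gamma (2 * \<alpha>)"
    using \<alpha> by (auto intro: Gamma_real_pos)
  have "Gamma (1 - \<alpha>) = - \<alpha> * Gamma (- \<alpha>)"
    using Gamma_plus1[OF minus_not_nonpos_Int] by simp
  then have "Gamma (- \<alpha>) = - (Gamma (1 - \<alpha>) / \<alpha>)"
    using \<alpha> by simp
  then have Gamma_minus: "\<bar>Gamma (- \<alpha>)\<bar> = Gamma (1 - \<alpha>) / \<alpha>"
    using pos(2) \<alpha>(1) by simp
  have duplication: "Gamma \<alpha> * Gamma ((1 + 2 * \<alpha>) / 2) = 2 powr (1 - 2 * \<alpha>) * sqrt pi * Gamma (2 * \<alpha>)"
  proof -
    have "complex_of_real \<alpha> \<notin> \<int>\<^sub>\<le>\<^sub>0" "complex_of_real \<alpha> + 1 / 2 \<notin> \<int>\<^sub>\<le>\<^sub>0"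
      using \<alpha> by (auto elim!: nonpos_Ints_cases simp: complex_eq_iff)
    from Gamma_legendre_duplication[OF this]
    have "complex_of_real (Gamma \<alpha> * Gamma (\<alpha> + 1 / 2)) =
        complex_of_real (exp ((1 - 2 * \<alpha>) * ln 2) * sqrt pi * Gamma (2 * \<alpha>))"
      by (simp add: Gamma_complex_of_real[symmetric] exp_of_real[symmetric])
    then have "Gamma \<alpha> * Gamma (\<alpha> + 1 / 2) = exp ((1 - 2 * \<alpha>) * ln 2) * sqrt pi * Gamma (2 * \<alpha>)"
      by (simp only: of_real_eq_iff)
    moreover have "(1 + 2 * \<alpha>) / 2 = \<alpha> + 1 / 2" by simp
    moreover have "exp ((1 - 2 * \<alpha>) * ln 2) = 2 powr (1 - 2 * \<alpha>)" by (simp add: powr_def)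
    ultimately show ?thesis by (simp only:)
  qed
  have pow: "2 powr (2 * \<alpha>) * 2 powr (1 - 2 * \<alpha>) = (2 :: real)"
    by (simp flip: powr_add)
  have Beta: "Beta \<alpha> (1 - \<alpha>) = Gamma \<alpha> * Gamma (1 - \<alpha>)" "Beta \<alpha> \<alpha> = (Gamma \<alpha>)\<^sup>2 / Gamma (2 * \<alpha>)"
    by (simp_all add: Beta_def power2_eq_square)
  have "frac_lap_const \<alpha> * (Beta \<alpha> (1 - \<alpha>) / (Gamma \<alpha>)\<^sup>2 * Beta \<alpha> \<alpha>) =
      \<alpha> * 2 powr (2 * \<alpha>) * (Gamma \<alpha> * Gamma ((1 + 2 * \<alpha>) / 2)) / (sqrt pi * Gamma (2 * \<alpha>))"
    unfolding frac_lap_const_def Beta Gamma_minus using pos \<alpha>(1) by simp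
  also have "\<dots> = \<alpha> * (2 powr (2 * \<alpha>) * 2 powr (1 - 2 * \<alpha>))"
    unfolding duplication using pos by simp
  finally show ?thesis
    unfolding pow by simp
qed

section \<open>Linearity and the maximum principle\<close>

lemma has_frac_laplacian_diff:
  assumes "has_frac_laplacian \<alpha> f x v" "has_frac_laplacian \<alpha> g x w"
  shows "has_frac_laplacian \<alpha> (\<lambda>y. f y - g y) x (v - w)"
proof -
  let ?W = "x powr (- 2 * \<alpha>) + (1 - x) powr (- 2 * \<alpha>)"
  let ?q = "\<lambda>u y. (u x - u y) / \<bar>x - y\<bar> powr (1 + 2 * \<alpha>)"
  obtain I J where I: "has_principal_value (?q f) x {0<..<1} I"
      "v = frac_lap_const \<alpha> * (I + f x / (2 * \<alpha>) * ?W)"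
    and J: "has_principal_value (?q g) x {0<..<1} J"
      "w = frac_lap_const \<alpha> * (J + g x / (2 * \<alpha>) * ?W)"
    using assms unfolding has_frac_laplacian_def by blast
  have q: "?q (\<lambda>y. f y - g y) = (\<lambda>y. ?q f y - ?q g y)"
    by (simp add: fun_eq_iff flip: diff_divide_distrib)
  have "has_principal_value (\<lambda>y. ?q f y - ?q g y) x {0<..<1} (I - J)"
    unfolding has_principal_value_def
  proof (intro conjI allI impI)
    show "set_integrable lborel {y \<in> {0<..<1}. \<epsilon> \<le> \<bar>x - y\<bar>} (\<lambda>y. ?q f y - ?q g y)" if "0 < \<epsilon>" for \<epsilon>
      using I(1) J(1) that unfolding has_principal_value_def by (intro set_integral_diff) auto
    have "((\<lambda>\<epsilon>. (LINT y:{y \<in> {0<..<1}. \<epsilon> \<le> \<bar>x - y\<bar>}|lborel. ?q f y) -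
          (LINT y:{y \<in> {0<..<1}. \<epsilon> \<le> \<bar>x - y\<bar>}|lborel. ?q g y)) \<longlongrightarrow> I - J) (at_right 0)"
      using I(1) J(1) unfolding has_principal_value_def by (intro tendsto_diff) auto
    \<comment> \<open>Additivity of the cut-off integrals rests on their absolute convergence, which
      is available for positive \<epsilon> only.\<close>
    moreover have "eventually (\<lambda>\<epsilon>::real. 0 < \<epsilon>) (at_right 0)"
      by (rule eventually_at_right_less)
    then have "eventually (\<lambda>\<epsilon>. (LINT y:{y \<in> {0<..<1}. \<epsilon> \<le> \<bar>x - y\<bar>}|lborel. ?q f y) -
          (LINT y:{y \<in> {0<..<1}. \<epsilon> \<le> \<bar>x - y\<bar>}|lborel. ?q g y) =
          (LINT y:{y \<in> {0<..<1}. \<epsilon> \<le> \<bar>x - y\<bar>}|lborel. ?q f y - ?q g y)) (at_right 0)"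
    proof eventually_elim
      case (elim \<epsilon>)
      then show ?case
        using I(1) J(1) unfolding has_principal_value_def by (intro set_integral_diff(2)[symmetric]) auto
    qed
    ultimately show "((\<lambda>\<epsilon>. LINT y:{y \<in> {0<..<1}. \<epsilon> \<le> \<bar>x - y\<bar>}|lborel. ?q f y - ?q g y) \<longlongrightarrow> I - J) (at_right 0)"
      by (rule Lim_transform_eventually)
  qed
  moreover have "v - w = frac_lap_const \<alpha> * (I - J + (f x - g x) / (2 * \<alpha>) * ?W)"
    unfolding I(2) J(2) by (simp add: algebra_simps diff_divide_distrib)
  ultimately show ?thesis
    unfolding has_frac_laplacian_def q by blast
qed

text \<open>At a maximum the integrand is nonnegative, hence so is the principal value. Strictness
  comes from the boundary term, which is positive together with \<open>g x\<close>.\<close>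

lemma frac_laplacian_pos_at_max:
  assumes x: "x \<in> {0<..<1}" and "has_frac_laplacian \<alpha> g x v"
    and max: "\<And>y. y \<in> {0<..<1} \<Longrightarrow> g y \<le> g x" and "0 < g x"
  shows "0 < v"
proof -
  obtain I where I: "has_principal_value (\<lambda>y. (g x - g y) / \<bar>x - y\<bar> powr (1 + 2 * \<alpha>)) x {0<..<1} I"
    "v = frac_lap_const \<alpha> * (I + g x / (2 * \<alpha>) * (x powr (- 2 * \<alpha>) + (1 - x) powr (- 2 * \<alpha>)))"
    using assms(2) unfolding has_frac_laplacian_def by blast
  have nonneg: "0 \<le> (LINT y:{y \<in> {0<..<1}. \<epsilon> \<le> \<bar>x - y\<bar>}|lborel. (g x - g y) / \<bar>x - y\<bar> powr (1 + 2 * \<alpha>))" for \<epsilon>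
    unfolding set_lebesgue_integral_def
    by (rule integral_nonneg_AE, rule AE_I2) (use max in \<open>auto simp: indicator_def\<close>)
  have lim: "((\<lambda>\<epsilon>. LINT y:{y \<in> {0<..<1}. \<epsilon> \<le> \<bar>x - y\<bar>}|lborel. (g x - g y) / \<bar>x - y\<bar> powr (1 + 2 * \<alpha>)) \<longlongrightarrow> I) (at_right 0)"
    using I(1) unfolding has_principal_value_def by blast
  have "0 \<le> I"
    by (rule tendsto_lowerbound[OF lim always_eventually[OF allI[OF nonneg]]]) simp
  moreover have "0 < g x / (2 * \<alpha>) * (x powr (- 2 * \<alpha>) + (1 - x) powr (- 2 * \<alpha>))"
    using x \<alpha> assms(4) by (auto intro!: mult_pos_pos divide_pos_pos add_pos_pos)
  ultimately show ?thesis
    unfolding I(2) using frac_lap_const_pos by (intro mult_pos_pos) auto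
qed

text \<open>If f exceeded g somewhere, continuity up to the boundary and the zero boundary values
  would give f - g a positive maximum in the interior, where its fractional Laplacian is h - h =
  0.\<close>

lemma dirichlet_solution_le:
  assumes f: "dirichlet_solution \<alpha> h f" and g: "dirichlet_solution \<alpha> h g" and x: "x \<in> {0..1}"
  shows "f x \<le> g x"
proof (rule ccontr)
  assume "\<not> f x \<le> g x"
  define u where "u = (\<lambda>y. f y - g y)"
  have "continuous_on {0..1} u"
    using f g unfolding u_def dirichlet_solution_def by (intro continuous_on_diff) auto
  then obtain m where m: "m \<in> {0..1}" "\<And>y. y \<in> {0..1} \<Longrightarrow> u y \<le> u m"
    using continuous_attains_sup[of "{0..1}" u] by auto
  have "0 < u m"
    using m(2)[OF x] \<open>\<not> f x \<le> g x\<close> by (simp add: u_def)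
  moreover have "u 0 = 0" "u 1 = 0"
    using f g by (auto simp: dirichlet_solution_def u_def)
  ultimately have mi: "m \<in> {0<..<1}"
    using m(1) by (metis atLeastAtMost_iff greaterThanLessThan_iff less_eq_real_def less_irrefl)
  have "has_frac_laplacian \<alpha> u m (h m - h m)"
    unfolding u_def by (rule has_frac_laplacian_diff) (use f g mi in \<open>auto simp: dirichlet_solution_def\<close>)
  from frac_laplacian_pos_at_max[OF mi this] m(2) \<open>0 < u m\<close> show False by auto
qed

section \<open>Bounds and odd potential of the Green solution\<close>

lemma borel_measurable_green_solution [measurable]:
  assumes [measurable]: "H \<in> borel_measurable borel"
  shows "green_solution \<alpha> H \<in> borel_measurable borel"
proof -
  note [measurable] = borel_measurable_green'[OF \<alpha>]
  have "green_solution \<alpha> H = (\<lambda>x. if 0 < x \<and> x < 1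
      then \<integral>y. (if 0 \<le> y \<and> y \<le> 1 then green \<alpha> x y * H y else 0) \<partial>lborel else 0)"
    by (intro ext) (auto simp: green_solution_def set_lebesgue_integral_def indicator_def
        intro!: Bochner_Integration.integral_cong)
  also have "\<dots> \<in> borel_measurable borel" by measurable
  finally show ?thesis .
qed

context
  fixes H :: "real \<Rightarrow> real" and B :: real
  assumes H_measurable [measurable]: "H \<in> borel_measurable borel"
    and H_le: "\<And>y. \<bar>H y\<bar> \<le> B"
begin

lemma bound_nonneg: "0 \<le> B"
  using H_le[of 0] by linarith

lemma
  assumes x: "x \<in> {0..1}"
  shows set_integrable_green_mult: "set_integrable lborel {0..1} (\<lambda>y. green \<alpha> x y * H y)"
    and set_integral_abs_green_mult_le: "(LINT y:{0..1}|lborel. \<bar>green \<alpha> x y * H y\<bar>)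
      \<le> B * (x * (1 - x)) powr \<alpha> / (\<alpha> * (Gamma \<alpha>)\<^sup>2) * (2 / \<alpha>)"
proof -
  note [measurable] = borel_measurable_green'[OF \<alpha>]
  let ?C = "B * (x * (1 - x)) powr \<alpha> / (\<alpha> * (Gamma \<alpha>)\<^sup>2)"
  let ?b = "\<lambda>y. ?C * \<bar>x - y\<bar> powr (\<alpha> - 1)"
  have int: "set_integrable lborel {0..1} ?b"
    by (intro set_integrable_mult_right set_integrable_abs_powr_unit) (use x \<alpha> in auto)
  have bound: "\<bar>green \<alpha> x y * H y\<bar> \<le> ?b y" for y
    using mult_mono[OF green_le[OF \<alpha> x, of y] H_le[of y]] green_nonneg[OF \<alpha>, of x y] bound_nonneg \<alpha>
    by (simp add: abs_mult mult_ac)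
  show *: "set_integrable lborel {0..1} (\<lambda>y. green \<alpha> x y * H y)"
  proof (rule set_integrable_bound[OF int])
    show "AE y in lborel. y \<in> {0..1} \<longrightarrow> norm (green \<alpha> x y * H y) \<le> norm (?b y)"
      unfolding real_norm_def by (intro AE_I2 impI order_trans[OF bound abs_ge_self])
  qed (simp add: set_borel_measurable_def)
  have "(LINT y:{0..1}|lborel. \<bar>green \<alpha> x y * H y\<bar>) \<le> (LINT y:{0..1}|lborel. ?b y)"
    by (rule set_integral_mono[OF set_integrable_abs[OF *] int bound])
  also have "\<dots> = ?C * (LINT y:{0..1}|lborel. \<bar>x - y\<bar> powr (\<alpha> - 1))"
    by (rule set_integral_mult_right)
  also have "\<dots> \<le> ?C * (2 / \<alpha>)"
    using set_integral_abs_powr_unit_le[of "\<alpha> - 1" x] x \<alpha> bound_nonneg by (intro mult_left_mono) auto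
  finally show "(LINT y:{0..1}|lborel. \<bar>green \<alpha> x y * H y\<bar>) \<le> ?C * (2 / \<alpha>)" .
qed

text \<open>The factor inherited from \<open>green_le\<close> makes the solution vanish continuously
  at 0 and 1.\<close>

lemma abs_green_solution_le:
  assumes x: "x \<in> {0..1}"
  shows "\<bar>green_solution \<alpha> H x\<bar> \<le> 2 * B / (\<alpha>\<^sup>2 * (Gamma \<alpha>)\<^sup>2) * (x * (1 - x)) powr \<alpha>"
proof (cases "0 < x \<and> x < 1")
  case True
  have "\<bar>LINT y:{0..1}|lborel. green \<alpha> x y * H y\<bar> \<le> (LINT y:{0..1}|lborel. \<bar>green \<alpha> x y * H y\<bar>)"
    using integral_abs_bound[of lborel "\<lambda>y. indicator {0..1} y * (green \<alpha> x y * H y)"]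
    by (simp add: set_lebesgue_integral_def abs_mult)
  with set_integral_abs_green_mult_le[OF x] True show ?thesis
    by (simp add: green_solution_def power2_eq_square mult_ac)
qed (use bound_nonneg \<alpha> in \<open>auto simp: green_solution_def\<close>)

text \<open>Fubini integrates the step function of \<open>set_integral_green_odd_kernel\<close>
  against H: the jump gives the integral of H up to x, and the last integral does not depend on x,
  so differentiation removes it.\<close>

lemma green_solution_potential:
  assumes x: "x \<in> {0<..<1}"
  shows "(LINT z:{0<..<1}|lborel. green_solution \<alpha> H z * odd_kernel \<alpha> (x - z)) =
    Beta \<alpha> (1 - \<alpha>) / (Gamma \<alpha>)\<^sup>2 * (Beta \<alpha> \<alpha> * (LINT y:{0<..<x}|lborel. H y) -
      (LINT y:{0<..<1}|lborel. incomplete_beta \<alpha> (1 - y) * H y))"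
proof -
  note [measurable] = borel_measurable_green'[OF \<alpha>]
  let ?k = "odd_kernel \<alpha>" and ?c = "Beta \<alpha> (1 - \<alpha>) / (Gamma \<alpha>)\<^sup>2"
  define \<Psi> where "\<Psi> z y = indicator {0<..<1} z * ?k (x - z) * (indicator {0..1} y * (green \<alpha> z y * H y))" for z y
  have [measurable]: "(\<lambda>(z, y). \<Psi> z y) \<in> borel_measurable (lborel \<Otimes>\<^sub>M lborel)"
    unfolding \<Psi>_def by measurable
  have int_k: "set_integrable lborel {0<..<1} (\<lambda>z. ?k (x - z))"
    using x by (intro set_integrable_odd_kernel[OF \<alpha>]) auto
  have inner: "(\<integral>y. \<Psi> z y \<partial>lborel) = indicator {0<..<1} z *\<^sub>R (green_solution \<alpha> H z * ?k (x - z))" for z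
    by (auto simp: \<Psi>_def green_solution_def set_lebesgue_integral_def indicator_def)
  have integrable: "integrable (lborel \<Otimes>\<^sub>M lborel) (\<lambda>(z, y). \<Psi> z y)"
  proof (rule lborel_pair.Fubini_integrable)
    let ?C = "B * 1 / (\<alpha> * (Gamma \<alpha>)\<^sup>2) * (2 / \<alpha>)"
    have "integrable lborel (\<lambda>z. ?C * (indicator {0<..<1} z * ?k (x - z)))"
      using int_k by (intro integrable_mult_right) (simp add: set_integrable_def)
    then show "integrable lborel (\<lambda>z. \<integral>y. norm (case (z, y) of (z, y) \<Rightarrow> \<Psi> z y) \<partial>lborel)"
    proof (rule Bochner_Integration.integrable_bound)
      show "AE z in lborel. norm (\<integral>y. norm (case (z, y) of (z, y) \<Rightarrow> \<Psi> z y) \<partial>lborel)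
          \<le> norm (?C * (indicator {0<..<1} z * ?k (x - z)))"
      proof (intro AE_I2)
        fix z
        show "norm (\<integral>y. norm (case (z, y) of (z, y) \<Rightarrow> \<Psi> z y) \<partial>lborel)
          \<le> norm (?C * (indicator {0<..<1} z * ?k (x - z)))"
        proof (cases "z \<in> {0<..<1}")
          case True
          have "(z * (1 - z)) powr \<alpha> \<le> 1 powr \<alpha>"
            using True \<alpha> by (intro powr_mono2) (auto intro: mult_le_one)
          then have "B * (z * (1 - z)) powr \<alpha> / (\<alpha> * (Gamma \<alpha>)\<^sup>2) * (2 / \<alpha>) \<le> ?C"
            using bound_nonneg \<alpha> by (intro mult_right_mono divide_right_mono mult_left_mono) auto
          with set_integral_abs_green_mult_le[of z] True
          have "(LINT y:{0..1}|lborel. \<bar>green \<alpha> z y * H y\<bar>) \<le> ?C" by simp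
          from mult_right_mono[OF this, of "\<bar>?k (x - z)\<bar>"]
          have "(LINT y:{0..1}|lborel. \<bar>green \<alpha> z y * H y\<bar>) * \<bar>?k (x - z)\<bar> \<le> \<bar>?C * ?k (x - z)\<bar>"
            using bound_nonneg \<alpha> by (simp add: abs_mult)
          moreover have "(\<integral>y. norm (\<Psi> z y) \<partial>lborel) = (LINT y:{0..1}|lborel. \<bar>green \<alpha> z y * H y\<bar>) * \<bar>?k (x - z)\<bar>"
            using True by (simp add: \<Psi>_def abs_mult set_lebesgue_integral_def mult.commute)
          moreover have "0 \<le> (\<integral>y. norm (\<Psi> z y) \<partial>lborel)" by simp
          ultimately show ?thesis using True by simp
        qed (simp add: \<Psi>_def)
      qed
    qed measurable
    show "AE z in lborel. integrable lborel (\<lambda>y. case (z, y) of (z, y) \<Rightarrow> \<Psi> z y)"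
    proof (intro AE_I2)
      fix z
      show "integrable lborel (\<lambda>y. case (z, y) of (z, y) \<Rightarrow> \<Psi> z y)"
        using set_integrable_green_mult[of z] by (cases "z \<in> {0<..<1}") (auto simp: \<Psi>_def set_integrable_def)
    qed
  qed simp
  have outer: "(\<integral>z. \<Psi> z y \<partial>lborel) = ?c * (Beta \<alpha> \<alpha> * (indicator {0<..<x} y *\<^sub>R H y) -
      indicator {0<..<1} y *\<^sub>R (incomplete_beta \<alpha> (1 - y) * H y))" if "y \<notin> {0, 1, x}" for y
  proof (cases "y \<in> {0<..<1}")
    case True
    have "\<Psi> z y = H y * (indicator {0<..<1} z * (green \<alpha> z y * ?k (x - z)))" for z
      using True by (simp add: \<Psi>_def indicator_def)
    then have "(\<integral>z. \<Psi> z y \<partial>lborel) = H y * (LINT z:{0<..<1}|lborel. green \<alpha> z y * ?k (x - z))"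
      by (simp add: set_lebesgue_integral_def)
    also have "\<dots> = H y * (?c * ((if y < x then Beta \<alpha> \<alpha> else 0) - incomplete_beta \<alpha> (1 - y)))"
      using set_integral_green_odd_kernel[OF \<alpha> x True] that by auto
    finally show ?thesis using True by (simp add: indicator_def right_diff_distrib mult_ac)
  next
    case False
    with that x show ?thesis by (auto simp: \<Psi>_def indicator_def)
  qed
  have int1: "set_integrable lborel {0<..<x} H"
  proof (rule set_integrable_bound)
    show "set_integrable lborel {0<..<x} (\<lambda>_. B)"
      using x by (simp add: set_integrable_def integrable_real_indicator)
  qed (use H_le bound_nonneg in \<open>auto simp: set_borel_measurable_def\<close>)
  have int2: "set_integrable lborel {0<..<1} (\<lambda>y. incomplete_beta \<alpha> (1 - y) * H y)"
  proof (rule set_integrable_bound)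
    show "set_integrable lborel {0<..<1::real} (\<lambda>_. Beta \<alpha> \<alpha> * B)"
      by (simp add: set_integrable_def)
    show "AE y in lborel. y \<in> {0<..<1} \<longrightarrow> norm (incomplete_beta \<alpha> (1 - y) * H y) \<le> norm (Beta \<alpha> \<alpha> * B)"
    proof (intro AE_I2 impI)
      fix y :: real assume "y \<in> {0<..<1}"
      then have "\<bar>incomplete_beta \<alpha> (1 - y)\<bar> \<le> Beta \<alpha> \<alpha>"
        using incomplete_beta_le[OF \<alpha>, of "1 - y"] incomplete_beta_nonneg[of \<alpha> "1 - y"] by simp
      moreover from this have "0 \<le> Beta \<alpha> \<alpha>" by linarith
      ultimately have "\<bar>incomplete_beta \<alpha> (1 - y)\<bar> * \<bar>H y\<bar> \<le> Beta \<alpha> \<alpha> * B"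
        using H_le[of y] by (intro mult_mono) auto
      then show "norm (incomplete_beta \<alpha> (1 - y) * H y) \<le> norm (Beta \<alpha> \<alpha> * B)"
        by (simp only: real_norm_def abs_mult order_trans[OF _ abs_ge_self[of "Beta \<alpha> \<alpha> * B", unfolded abs_mult]])
    qed
  qed (simp add: set_borel_measurable_def)
  have "(LINT z:{0<..<1}|lborel. green_solution \<alpha> H z * ?k (x - z)) = (\<integral>z. \<integral>y. \<Psi> z y \<partial>lborel \<partial>lborel)"
    unfolding inner set_lebesgue_integral_def ..
  also have "\<dots> = (\<integral>y. \<integral>z. \<Psi> z y \<partial>lborel \<partial>lborel)"
    using lborel_pair.Fubini_integral[of \<Psi>] integrable by simp
  also have "\<dots> = (\<integral>y. ?c * (Beta \<alpha> \<alpha> * (indicator {0<..<x} y *\<^sub>R H y) -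
      indicator {0<..<1} y *\<^sub>R (incomplete_beta \<alpha> (1 - y) * H y)) \<partial>lborel)"
  proof (rule integral_cong_AE)
    have "AE y in lborel. y \<notin> {0, 1, x}"
      by (rule AE_not_in) (simp add: finite_imp_null_set_lborel)
    then show "AE y in lborel. (\<integral>z. \<Psi> z y \<partial>lborel) = ?c * (Beta \<alpha> \<alpha> * (indicator {0<..<x} y *\<^sub>R H y) -
      indicator {0<..<1} y *\<^sub>R (incomplete_beta \<alpha> (1 - y) * H y))"
      by eventually_elim (rule outer)
  qed measurable
  also have "\<dots> = ?c * (Beta \<alpha> \<alpha> * (LINT y:{0<..<x}|lborel. H y) -
      (LINT y:{0<..<1}|lborel. incomplete_beta \<alpha> (1 - y) * H y))"
    using int1 int2 unfolding set_integrable_def set_lebesgue_integral_def by simp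
  finally show ?thesis .
qed

end
end

section \<open>Regularity of the Green solution\<close>

context
  fixes \<alpha> :: real
  assumes \<alpha>: "0 < \<alpha>" "\<alpha> < 1 / 2"
begin

lemma powr_diff_Lipschitz:
  assumes "0 < \<rho>" "\<rho> \<le> v" "\<rho> \<le> w"
  shows "\<bar>v powr (\<alpha> - 1) - w powr (\<alpha> - 1)\<bar> \<le> \<rho> powr (\<alpha> - 2) * \<bar>v - w\<bar>"
proof -
  have "norm (v powr (\<alpha> - 1) - w powr (\<alpha> - 1)) \<le> \<rho> powr (\<alpha> - 2) * norm (v - w)"
  proof (rule field_differentiable_bound[where S="{\<rho>..}" and f'="\<lambda>v. (\<alpha> - 1) * v powr (\<alpha> - 2)"])
    show "((\<lambda>v. v powr (\<alpha> - 1)) has_field_derivative (\<alpha> - 1) * v powr (\<alpha> - 2)) (at v within {\<rho>..})"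
      if "v \<in> {\<rho>..}" for v
    proof -
      have "((\<lambda>v. v powr (\<alpha> - 1)) has_field_derivative (\<alpha> - 1) * v powr (\<alpha> - 1 - 1)) (at v)"
        using that assms by (auto intro!: derivative_eq_intros)
      then show ?thesis by (simp add: has_field_derivative_at_within)
    qed
    show "norm ((\<alpha> - 1) * v powr (\<alpha> - 2)) \<le> \<rho> powr (\<alpha> - 2)" if "v \<in> {\<rho>..}" for v
    proof -
      have "\<bar>\<alpha> - 1\<bar> * v powr (\<alpha> - 2) \<le> 1 * \<rho> powr (\<alpha> - 2)"
        using that assms \<alpha> by (intro mult_mono powr_mono2') auto
      then show ?thesis by (simp add: abs_mult)
    qed
  qed (use assms in auto)
  then show ?thesis by simp
qed

lemma green_kernel_split:
  assumes "0 < \<rho>" "\<rho> \<le> p" "0 < d"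
  shows "green_kernel \<alpha> p d = green_kernel \<alpha> \<rho> d +
    (LINT s:{\<rho>..<p}|lborel. s powr (\<alpha> - 1) * (s + d) powr (\<alpha> - 1))"
proof -
  note int = set_integrable_green_kernel[OF \<alpha> assms(3), of p]
  have eq: "{0<..<p} = {0<..<\<rho>} \<union> {\<rho>..<p}" using assms by auto
  show ?thesis
    unfolding green_kernel_def
    by (subst eq, rule set_integral_Un) (use assms in \<open>auto intro!: set_integrable_subset[OF int]\<close>)
qed

text \<open>For s at least \<rho> both factors of the integrand are at most \<rho>^(\<alpha>-1), and
  the second has derivative in d at most \<rho>^(\<alpha>-2). Changing p and d one at a time gives
  the two terms. The bound does not deteriorate as d tends to 0, so the tail is Lipschitz up to the
  diagonal.\<close>

lemma green_kernel_tail_Lipschitz: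
  assumes \<rho>: "0 < \<rho>" and p: "\<rho> \<le> p" "p \<le> 1" "\<rho> \<le> q" "q \<le> 1" and d: "0 < d" "0 < e"
  shows "\<bar>(green_kernel \<alpha> p d - green_kernel \<alpha> \<rho> d) - (green_kernel \<alpha> q e - green_kernel \<alpha> \<rho> e)\<bar>
    \<le> \<rho> powr (\<alpha> - 1) * (\<rho> powr (\<alpha> - 1) * \<bar>p - q\<bar> + \<rho> powr (\<alpha> - 2) * \<bar>d - e\<bar>)"
proof -
  have first: "\<bar>green_kernel \<alpha> p d - green_kernel \<alpha> q d\<bar> \<le> \<rho> powr (\<alpha> - 1) * \<rho> powr (\<alpha> - 1) * (p - q)"
    if pq: "\<rho> \<le> q" "q \<le> p" and d: "0 < d" for p q d
  proof -
    let ?f = "\<lambda>s. s powr (\<alpha> - 1) * (s + d) powr (\<alpha> - 1)"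
    have int: "set_integrable lborel {q..<p} ?f"
      using pq \<rho> d by (intro set_integrable_subset[OF set_integrable_green_kernel[OF \<alpha> d, of p]]) auto
    have int_c: "set_integrable lborel {q..<p} (\<lambda>_. \<rho> powr (\<alpha> - 1) * \<rho> powr (\<alpha> - 1))"
      using pq by (auto simp: set_integrable_def integrable_real_indicator)
    have eq: "green_kernel \<alpha> p d - green_kernel \<alpha> q d = (LINT s:{q..<p}|lborel. ?f s)"
      using green_kernel_split[of q p d] pq \<rho> d by simp
    have "(LINT s:{q..<p}|lborel. ?f s) \<le> (LINT s:{q..<p}|lborel. \<rho> powr (\<alpha> - 1) * \<rho> powr (\<alpha> - 1))"
      by (rule set_integral_mono[OF int int_c])
         (use pq \<rho> \<alpha> d in \<open>auto intro!: mult_mono powr_mono2'\<close>)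
    also have "\<dots> = \<rho> powr (\<alpha> - 1) * \<rho> powr (\<alpha> - 1) * (p - q)"
      using pq by (simp add: set_lebesgue_integral_def)
    finally have "(LINT s:{q..<p}|lborel. ?f s) \<le> \<rho> powr (\<alpha> - 1) * \<rho> powr (\<alpha> - 1) * (p - q)" .
    moreover have "0 \<le> (LINT s:{q..<p}|lborel. ?f s)"
      unfolding set_lebesgue_integral_def by (rule integral_nonneg_AE) auto
    ultimately show ?thesis unfolding eq by simp
  qed
  have second: "\<bar>(green_kernel \<alpha> p d - green_kernel \<alpha> \<rho> d) - (green_kernel \<alpha> p e - green_kernel \<alpha> \<rho> e)\<bar>
      \<le> \<rho> powr (\<alpha> - 1) * (\<rho> powr (\<alpha> - 2) * \<bar>d - e\<bar>)"
  proof -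
    let ?f = "\<lambda>d s. s powr (\<alpha> - 1) * (s + d) powr (\<alpha> - 1)"
    let ?c = "\<rho> powr (\<alpha> - 1) * (\<rho> powr (\<alpha> - 2) * \<bar>d - e\<bar>)"
    have int: "set_integrable lborel {\<rho>..<p} (?f d)" "set_integrable lborel {\<rho>..<p} (?f e)"
      using \<rho> p d by (auto intro!: set_integrable_subset[OF set_integrable_green_kernel[OF \<alpha>, of _ p]])
    have "\<bar>LINT s:{\<rho>..<p}|lborel. ?f d s - ?f e s\<bar> \<le> (LINT s:{\<rho>..<p}|lborel. ?c)"
      unfolding set_lebesgue_integral_def
    proof (rule integral_abs_bound_integral)
      show "integrable lborel (\<lambda>s. indicator {\<rho>..<p} s *\<^sub>R (?f d s - ?f e s))"
        using set_integral_diff(1)[OF int] by (simp add: set_integrable_def)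
      show "integrable lborel (\<lambda>s. indicator {\<rho>..<p} s *\<^sub>R ?c)"
        using p by (auto simp: integrable_real_indicator)
      show "\<bar>indicator {\<rho>..<p} s *\<^sub>R (?f d s - ?f e s)\<bar> \<le> indicator {\<rho>..<p} s *\<^sub>R ?c" for s
      proof (cases "s \<in> {\<rho>..<p}")
        case True
        have "s powr (\<alpha> - 1) * \<bar>(s + d) powr (\<alpha> - 1) - (s + e) powr (\<alpha> - 1)\<bar> \<le> ?c"
          using True \<rho> \<alpha> d powr_diff_Lipschitz[OF \<rho>, of "s + d" "s + e"]
          by (intro mult_mono powr_mono2') auto
        then show ?thesis using True by (simp add: abs_mult flip: right_diff_distrib)
      qed simp
    qed
    also have "\<dots> = (p - \<rho>) * ?c"
      using p by (simp add: set_lebesgue_integral_def)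
    also have "\<dots> \<le> 1 * ?c"
      using p \<rho> by (intro mult_right_mono) auto
    finally show ?thesis
      using green_kernel_split[of \<rho> p] \<rho> p d set_integral_diff(2)[OF int] by simp
  qed
  have "\<bar>green_kernel \<alpha> p e - green_kernel \<alpha> q e\<bar> \<le> \<rho> powr (\<alpha> - 1) * (\<rho> powr (\<alpha> - 1) * \<bar>p - q\<bar>)"
    using first[of q p e] first[of p q e] p d by (cases "q \<le> p") (auto simp: abs_minus_commute)
  with second show ?thesis by (simp add: distrib_left)
qed

context
  fixes H :: "real \<Rightarrow> real" and a b :: real
  assumes lip: "1-lipschitz_on UNIV H"
    and ab: "0 < a" "a \<le> b" "b < 1"
    and supp: "\<And>y. y \<notin> {a..b} \<Longrightarrow> H y = 0"
begin

private lemma H_lip: "\<bar>H y - H z\<bar> \<le> \<bar>y - z\<bar>"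
  using lipschitz_onD[OF lip, of y z] by (simp add: dist_real_def)

lemma H_measurable [measurable]: "H \<in> borel_measurable borel"
  by (rule borel_measurable_continuous_onI) (rule lipschitz_on_continuous_on[OF lip])

lemma H_le_one: "\<bar>H y\<bar> \<le> 1"
proof (cases "y \<in> {0..1}")
  case True
  then show ?thesis using H_lip[of y 0] supp[of 0] ab by auto
next
  case False
  then show ?thesis using supp[of y] ab by auto
qed

text \<open>Below the level \<open>\<rho>\<close> the Green kernel is a function of \<open>x - y\<close>, so that part of
  the integral inherits the modulus of continuity of \<open>H\<close>; above it the kernel is smooth.\<close>
lemma green_solution_Lipschitz:
  assumes cd: "0 < c" "c \<le> d" "d < 1"
  shows "\<exists>K>0. K-lipschitz_on {c..d} (green_solution \<alpha> H)"
proof -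
  note [measurable] = borel_measurable_green'[OF \<alpha>]
  \<comment> \<open>A positive lower bound for \<open>p x y\<close> over all x in [c,d] and y in
    [a,b], so that one cut serves all pairs.\<close>
  define \<rho> where "\<rho> = min a c * (1 - max b d)"
  have \<rho>: "0 < \<rho>" using ab cd by (auto simp: \<rho>_def)
  define p where "p x y = min x y * (1 - max x y)" for x y :: real
  have p: "\<rho> \<le> p x y" "p x y \<le> 1" if "x \<in> {c..d}" "y \<in> {a..b}" for x y
  proof -
    show "\<rho> \<le> p x y"
      unfolding \<rho>_def p_def using that ab cd by (intro mult_mono) auto
    show "p x y \<le> 1"
      unfolding p_def using that ab cd by (intro mult_le_one) auto
  qed
  \<comment> \<open>\<open>A (x - y)\<close> is the singular part of the kernel and depends on x - y
    only; \<open>T\<close> below is the tail.\<close>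
  define A where "A s = green_kernel \<alpha> \<rho> \<bar>s\<bar>" for s
  have A_eq: "A = (\<lambda>s. \<integral>t. (if 0 < t \<and> t < \<rho> then t powr (\<alpha> - 1) * (t + \<bar>s\<bar>) powr (\<alpha> - 1) else 0) \<partial>lborel)"
    by (intro ext) (auto simp: A_def green_kernel_def set_lebesgue_integral_def indicator_def
        intro!: Bochner_Integration.integral_cong)
  have [measurable]: "A \<in> borel_measurable borel"
    unfolding A_eq by measurable
  \<comment> \<open>The constant of \<open>green_kernel_tail_Lipschitz\<close> when p moves by at
    most 2 |x - x'| and d by at most |x - x'|.\<close>
  define L where "L = \<rho> powr (\<alpha> - 1) * (\<rho> powr (\<alpha> - 1) * 2 + \<rho> powr (\<alpha> - 2))"
  define T where "T x y = green_kernel \<alpha> (p x y) \<bar>x - y\<bar> - A (x - y)" for x y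
  define M where "M = (LINT s:{-1..1}|lborel. A s)"
  have L: "0 \<le> L" by (simp add: L_def)
  have int_A: "set_integrable lborel {-1..1} A"
  proof (rule set_integrable_bound)
    \<comment> \<open>\<open>green_kernel_le\<close> requires a positive distance; the indicator
      term covers the single point s = 0.\<close>
    show "set_integrable lborel {-1..1} (\<lambda>s. \<rho> powr \<alpha> / \<alpha> * \<bar>0 - s\<bar> powr (\<alpha> - 1) + indicator {0} s * A 0)"
      using set_integrable_abs_powr[of "\<alpha> - 1" 1 0] \<alpha>
      by (intro set_integral_add set_integrable_mult_right)
         (auto simp: set_integrable_def mult.assoc[symmetric] simp flip: indicator_inter_arith
           intro!: integrable_mult_left integrable_real_indicator)
    show "AE s in lborel. s \<in> {-1..1} \<longrightarrow>
        norm (A s) \<le> norm (\<rho> powr \<alpha> / \<alpha> * \<bar>0 - s\<bar> powr (\<alpha> - 1) + indicator {0} s * A 0)"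
    proof (intro AE_I2 impI)
      fix s
      show "norm (A s) \<le> norm (\<rho> powr \<alpha> / \<alpha> * \<bar>0 - s\<bar> powr (\<alpha> - 1) + indicator {0} s * A 0)"
        using green_kernel_le[OF \<alpha>, of "\<bar>s\<bar>" \<rho>] green_kernel_nonneg[OF \<alpha>, of \<rho> "\<bar>s\<bar>"] \<rho> \<alpha>
        by (cases "s = 0") (auto simp: A_def)
    qed
  qed (simp add: set_borel_measurable_def)
  have A_nonneg: "0 \<le> A s" for s
    by (simp add: A_def green_kernel_nonneg[OF \<alpha>])
  have M: "0 \<le> M"
    unfolding M_def set_lebesgue_integral_def by (rule integral_nonneg_AE) (use A_nonneg in auto)
  \<comment> \<open>H (x - s) vanishes unless x - s lies in [a,b], which for x in [0,1] forces |s| <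
    1.\<close>
  have conv_eq: "(\<lambda>s. indicator {-1..1} s * (A s * H (x - s))) = (\<lambda>s. A s * H (x - s))" if "x \<in> {0..1}" for x
  proof
    fix s
    show "indicator {-1..1} s * (A s * H (x - s)) = A s * H (x - s)"
      using supp[of "x - s"] that ab by (cases "s \<in> {-1..1}") auto
  qed
  have int_AH: "integrable lborel (\<lambda>s. A s * H (x - s))" if "x \<in> {0..1}" for x
  proof -
    have "integrable lborel (\<lambda>s. indicator {-1..1} s * (A s * H (x - s)))"
    proof (rule Bochner_Integration.integrable_bound)
      show "integrable lborel (\<lambda>s. indicator {-1..1} s * A s)"
        using int_A by (simp add: set_integrable_def)
      show "AE s in lborel. norm (indicator {-1..1} s * (A s * H (x - s))) \<le> norm (indicator {-1..1} s * A s)"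
        using A_nonneg H_le_one by (intro AE_I2) (simp add: abs_mult mult_left_le indicator_def)
    qed measurable
    then show ?thesis unfolding conv_eq[OF that] .
  qed
  \<comment> \<open>The translation moves x from the singular \<open>A\<close> to the Lipschitz
    function \<open>H\<close>, so that an increment in x costs only the integral of
    \<open>A\<close>.\<close>
  have conv: "(\<integral>y. A (x - y) * H y \<partial>lborel) = (\<integral>s. A s * H (x - s) \<partial>lborel)" for x
    using lborel_integral_real_affine[of "-1" "\<lambda>y. A (x - y) * H y" x] by simp
  have int_AH': "integrable lborel (\<lambda>y. A (x - y) * H y)" if "x \<in> {0..1}" for x
    using lborel_integrable_real_affine[OF int_AH[OF that], of "-1" x] by simp
  have first: "\<bar>(\<integral>y. A (x - y) * H y \<partial>lborel) - (\<integral>y. A (x' - y) * H y \<partial>lborel)\<bar> \<le> M * \<bar>x - x'\<bar>"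
    if x: "x \<in> {c..d}" "x' \<in> {c..d}" for x x'
  proof -
    have x01: "x \<in> {0..1}" "x' \<in> {0..1}" using x cd by auto
    have "\<bar>\<integral>s. A s * H (x - s) - A s * H (x' - s) \<partial>lborel\<bar> \<le> (\<integral>s. indicator {-1..1} s * A s * \<bar>x - x'\<bar> \<partial>lborel)"
    proof (rule integral_abs_bound_integral)
      show "integrable lborel (\<lambda>s. A s * H (x - s) - A s * H (x' - s))"
        by (intro Bochner_Integration.integrable_diff int_AH x01)
      show "integrable lborel (\<lambda>s. indicator {-1..1} s * A s * \<bar>x - x'\<bar>)"
        using int_A by (intro integrable_mult_left) (simp add: set_integrable_def)
      fix s
      have "\<bar>A s * H (x - s) - A s * H (x' - s)\<bar> = indicator {-1..1} s * (A s * \<bar>H (x - s) - H (x' - s)\<bar>)"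
        using fun_cong[OF conv_eq[OF x01(1)], of s] fun_cong[OF conv_eq[OF x01(2)], of s] A_nonneg[of s]
        by (cases "s \<in> {-1..1}") (auto simp: abs_mult simp flip: right_diff_distrib)
      also have "\<dots> \<le> indicator {-1..1} s * (A s * \<bar>x - x'\<bar>)"
        using H_lip[of "x - s" "x' - s"] A_nonneg[of s] by (intro mult_left_mono) auto
      finally show "\<bar>A s * H (x - s) - A s * H (x' - s)\<bar> \<le> indicator {-1..1} s * A s * \<bar>x - x'\<bar>"
        by (simp add: mult.assoc)
    qed
    also have "\<dots> = M * \<bar>x - x'\<bar>"
      by (simp add: M_def set_lebesgue_integral_def)
    finally show ?thesis
      unfolding conv Bochner_Integration.integral_diff[OF int_AH[OF x01(1)] int_AH[OF x01(2)]] .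
  qed
  have T_lip: "\<bar>T x y - T x' y\<bar> \<le> L * \<bar>x - x'\<bar>"
    if x: "x \<in> {c..d}" "x' \<in> {c..d}" and y: "y \<in> {a..b}" and ne: "y \<noteq> x" "y \<noteq> x'" for x x' y
  proof -
    have "\<bar>p x y - p x' y\<bar> \<le> 2 * \<bar>x - x'\<bar>"
    proof -
      have 1: "\<bar>min x y - min x' y\<bar> \<le> \<bar>x - x'\<bar>" "\<bar>max x y - max x' y\<bar> \<le> \<bar>x - x'\<bar>"
        by (auto simp: min_def max_def)
      have eq: "p x y - p x' y = (min x y - min x' y) * (1 - max x y) + min x' y * (max x' y - max x y)"
        by (simp add: p_def algebra_simps)
      have 2: "\<bar>1 - max x y\<bar> \<le> 1" "\<bar>min x' y\<bar> \<le> 1"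
        using x y ab cd by (auto simp: max_def min_def)
      have "\<bar>(min x y - min x' y) * (1 - max x y)\<bar> \<le> \<bar>x - x'\<bar> * 1"
        unfolding abs_mult by (rule mult_mono[OF 1(1) 2(1)]) simp_all
      moreover have "\<bar>min x' y * (max x' y - max x y)\<bar> \<le> 1 * \<bar>x - x'\<bar>"
        unfolding abs_mult using 1(2) by (intro mult_mono 2(2)) (simp_all add: abs_minus_commute)
      ultimately show ?thesis
        unfolding eq by (intro order_trans[OF abs_triangle_ineq]) simp
    qed
    then have "\<rho> powr (\<alpha> - 1) * \<bar>p x y - p x' y\<bar> \<le> \<rho> powr (\<alpha> - 1) * (2 * \<bar>x - x'\<bar>)"
      by (intro mult_left_mono) auto
    moreover have "\<rho> powr (\<alpha> - 2) * \<bar>\<bar>x - y\<bar> - \<bar>x' - y\<bar>\<bar> \<le> \<rho> powr (\<alpha> - 2) * \<bar>x - x'\<bar>"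
      by (intro mult_left_mono) auto
    ultimately have "\<rho> powr (\<alpha> - 1) * (\<rho> powr (\<alpha> - 1) * \<bar>p x y - p x' y\<bar> + \<rho> powr (\<alpha> - 2) * \<bar>\<bar>x - y\<bar> - \<bar>x' - y\<bar>\<bar>)
        \<le> \<rho> powr (\<alpha> - 1) * (\<rho> powr (\<alpha> - 1) * (2 * \<bar>x - x'\<bar>) + \<rho> powr (\<alpha> - 2) * \<bar>x - x'\<bar>)"
      by (rule mult_left_mono[OF add_mono]) simp
    also have "\<dots> = L * \<bar>x - x'\<bar>" by (simp add: L_def algebra_simps)
    finally show ?thesis
      using green_kernel_tail_Lipschitz[OF \<rho> p[OF x(1) y] p[OF x(2) y], of "\<bar>x - y\<bar>" "\<bar>x' - y\<bar>"] ne
      by (simp add: T_def A_def)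
  qed
  have decomp: "green \<alpha> x y * H y * (Gamma \<alpha>)\<^sup>2 = A (x - y) * H y + T x y * H y"
    if "x \<in> {c..d}" "y \<noteq> x" for x y
  proof (cases "y \<in> {a..b}")
    case True
    then show ?thesis
      using green_eq_kernel[OF \<alpha>, of x y] that ab cd Gamma_real_pos[of \<alpha>, THEN less_imp_neq] \<alpha>
      by (simp add: T_def p_def algebra_simps)
  qed (simp add: supp)
  have int_G: "integrable lborel (\<lambda>y. green \<alpha> x y * H y)" and
    G_eq: "green_solution \<alpha> H x = (\<integral>y. green \<alpha> x y * H y \<partial>lborel)" if x: "x \<in> {c..d}" for x
  proof -
    have ind: "indicator {0..1} y * (green \<alpha> x y * H y) = green \<alpha> x y * H y" for y
      using ab supp[of y] by (cases "y \<in> {0..1}") auto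
    show "integrable lborel (\<lambda>y. green \<alpha> x y * H y)"
      using set_integrable_green_mult[OF \<alpha> H_measurable H_le_one, of x] x cd
      by (simp add: set_integrable_def ind)
    show "green_solution \<alpha> H x = (\<integral>y. green \<alpha> x y * H y \<partial>lborel)"
      using x cd by (simp add: green_solution_def set_lebesgue_integral_def ind)
  qed
  have second: "\<bar>(Gamma \<alpha>)\<^sup>2 * (green_solution \<alpha> H x - green_solution \<alpha> H x') -
      ((\<integral>y. A (x - y) * H y \<partial>lborel) - (\<integral>y. A (x' - y) * H y \<partial>lborel))\<bar> \<le> L * \<bar>x - x'\<bar>"
    if x: "x \<in> {c..d}" "x' \<in> {c..d}" for x x'
  proof -
    have x01: "x \<in> {0..1}" "x' \<in> {0..1}" using x cd by auto
    let ?D = "\<lambda>y. (Gamma \<alpha>)\<^sup>2 * (green \<alpha> x y * H y - green \<alpha> x' y * H y) - (A (x - y) * H y - A (x' - y) * H y)"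
    have int_D: "integrable lborel ?D"
      by (intro Bochner_Integration.integrable_diff integrable_mult_right int_G int_AH' x x01)
    have "norm (\<integral>y. ?D y \<partial>lborel) \<le> (\<integral>y. norm (?D y) \<partial>lborel)"
      by (rule integral_norm_bound)
    also have "\<dots> \<le> (\<integral>y. indicator {a..b} y * (L * \<bar>x - x'\<bar>) \<partial>lborel)"
    proof (rule integral_mono_AE)
      show "integrable lborel (\<lambda>y. norm (?D y))" using int_D by (rule integrable_norm)
      show "integrable lborel (\<lambda>y. indicator {a..b} y * (L * \<bar>x - x'\<bar>))"
        using ab by (intro integrable_mult_left integrable_real_indicator) auto
      have "AE y in lborel. y \<notin> {x, x'}"
        by (rule AE_not_in) (simp add: finite_imp_null_set_lborel)
      then show "AE y in lborel. norm (?D y) \<le> indicator {a..b} y * (L * \<bar>x - x'\<bar>)"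
      proof eventually_elim
        case (elim y)
        have D: "?D y = (T x y - T x' y) * H y"
          using decomp[OF x(1), of y] decomp[OF x(2), of y] elim by (simp add: algebra_simps)
        show ?case
        proof (cases "y \<in> {a..b}")
          case True
          have "\<bar>T x y - T x' y\<bar> * \<bar>H y\<bar> \<le> L * \<bar>x - x'\<bar> * 1"
            using T_lip[OF x True] elim H_le_one L by (intro mult_mono) auto
          then show ?thesis unfolding D using True by (simp add: abs_mult)
        qed (simp add: supp)
      qed
    qed
    also have "\<dots> = (b - a) * (L * \<bar>x - x'\<bar>)"
      using ab by simp
    also have "\<dots> \<le> 1 * (L * \<bar>x - x'\<bar>)"
      using ab L by (intro mult_right_mono) auto
    also have "(\<integral>y. ?D y \<partial>lborel) = (Gamma \<alpha>)\<^sup>2 * (green_solution \<alpha> H x - green_solution \<alpha> H x') -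
      ((\<integral>y. A (x - y) * H y \<partial>lborel) - (\<integral>y. A (x' - y) * H y \<partial>lborel))"
      unfolding G_eq[OF x(1)] G_eq[OF x(2)]
      by (simp add: int_G[OF x(1)] int_G[OF x(2)] int_AH'[OF x01(1)] int_AH'[OF x01(2)])
    finally show ?thesis by simp
  qed
  \<comment> \<open>The added 1 makes the constant strictly positive without any information on
    \<open>M + L\<close>.\<close>
  define K where "K = (M + L) / (Gamma \<alpha>)\<^sup>2 + 1"
  have G: "0 < (Gamma \<alpha>)\<^sup>2"
    by (rule zero_less_power) (rule Gamma_real_pos[OF \<alpha>(1)])
  have "K-lipschitz_on {c..d} (green_solution \<alpha> H)"
  proof (rule lipschitz_onI)
    show "0 \<le> K" using M L by (simp add: K_def)
    fix x x' assume x: "x \<in> {c..d}" "x' \<in> {c..d}"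
    have "(Gamma \<alpha>)\<^sup>2 * \<bar>green_solution \<alpha> H x - green_solution \<alpha> H x'\<bar> \<le> (M + L) * \<bar>x - x'\<bar>"
      using first[OF x] second[OF x] G
      by (simp add: distrib_right abs_mult[of "(Gamma \<alpha>)\<^sup>2", simplified, symmetric])
    then have "\<bar>green_solution \<alpha> H x - green_solution \<alpha> H x'\<bar> \<le> (M + L) / (Gamma \<alpha>)\<^sup>2 * \<bar>x - x'\<bar>"
      using G by (simp add: pos_le_divide_eq mult.commute)
    also have "\<dots> \<le> K * \<bar>x - x'\<bar>"
      by (intro mult_right_mono) (auto simp: K_def)
    finally show "dist (green_solution \<alpha> H x) (green_solution \<alpha> H x') \<le> K * dist x x'"
      by (simp add: dist_real_def)
  qed
  moreover have "0 < K" using M L G by (simp add: K_def add_nonneg_pos)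
  ultimately show ?thesis by blast
qed

text \<open>Inside, continuity follows from the Lipschitz bound on a neighbourhood; at the end
  points it follows from the power bound of \<open>abs_green_solution_le\<close>.\<close>

lemma continuous_on_green_solution: "continuous_on {0..1} (green_solution \<alpha> H)"
proof -
  let ?u = "green_solution \<alpha> H"
  have "(?u \<longlongrightarrow> ?u x) (at x within {0..1})" if x: "x \<in> {0..1}" for x
  proof (cases "0 < x \<and> x < 1")
    case True
    then obtain K where "K-lipschitz_on {x/2..(x+1)/2} ?u"
      using green_solution_Lipschitz[of "x/2" "(x+1)/2"] by auto
    then have "continuous_on {x/2..(x+1)/2} ?u" by (rule lipschitz_on_continuous_on)
    then have "isCont ?u x"
      by (rule continuous_on_interior) (use True in auto)
    then show ?thesis by (simp add: isCont_def tendsto_within_subset[OF _ subset_UNIV])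
  next
    case False
    let ?C = "2 * 1 / (\<alpha>\<^sup>2 * (Gamma \<alpha>)\<^sup>2)"
    have u0: "?u x = 0" using False by (auto simp: green_solution_def)
    have x0: "x * (1 - x) = 0" using False x by auto
    have "((\<lambda>y. ?C * (y * (1 - y)) powr \<alpha>) \<longlongrightarrow> ?C * (x * (1 - x)) powr \<alpha>) (at x within {0..1})"
      using \<alpha> by (intro tendsto_intros tendsto_powr') (auto simp: eventually_at_topological intro!: exI[of _ UNIV] mult_nonneg_nonneg)
    then have "((\<lambda>y. ?C * (y * (1 - y)) powr \<alpha>) \<longlongrightarrow> 0) (at x within {0..1})"
      unfolding x0 by simp
    moreover have "eventually (\<lambda>y. norm (?u y) \<le> ?C * (y * (1 - y)) powr \<alpha>) (at x within {0..1})"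
      unfolding eventually_at_filter real_norm_def
      using abs_green_solution_le[OF \<alpha> H_measurable H_le_one] by (intro always_eventually) blast
    ultimately show ?thesis
      unfolding u0 by (rule Lim_null_comparison[rotated])
  qed
  then show ?thesis by (simp add: continuous_on_def)
qed

lemma has_frac_laplacian_green_solution:
  assumes x: "x \<in> {0<..<1}"
  shows "has_frac_laplacian \<alpha> (green_solution \<alpha> H) x (H x)"
proof -
  let ?u = "green_solution \<alpha> H" and ?c = "Beta \<alpha> (1 - \<alpha>) / (Gamma \<alpha>)\<^sup>2"
  let ?A = "LINT y:{0<..<1}|lborel. incomplete_beta \<alpha> (1 - y) * H y"
  obtain K where K: "0 < K" "K-lipschitz_on {x/2..(x+1)/2} ?u"
    using green_solution_Lipschitz[of "x/2" "(x+1)/2"] x by auto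
  \<comment> \<open>The ball of radius r around x stays within the interval [x/2, (x+1)/2], where
    the Lipschitz constant \<open>K\<close> is valid. Beyond r boundedness is enough: 2 ?C is at
    most (2 ?C / r) |x - z|. This yields a bound at x that is global in z.\<close>
  define r where "r = min x (1 - x) / 2"
  have r: "0 < r" using x by (simp add: r_def)
  let ?C = "2 * 1 / (\<alpha>\<^sup>2 * (Gamma \<alpha>)\<^sup>2)"
  have u_le: "\<bar>?u z\<bar> \<le> ?C" if "z \<in> {0..1}" for z
  proof -
    have "(z * (1 - z)) powr \<alpha> \<le> 1 powr \<alpha>"
      using that \<alpha> by (intro powr_mono2) (auto intro: mult_le_one)
    then have "?C * (z * (1 - z)) powr \<alpha> \<le> ?C * 1"
      by (intro mult_left_mono) auto
    with abs_green_solution_le[OF \<alpha> H_measurable H_le_one that] show ?thesis by simp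
  qed
  have lip_x: "\<bar>?u z - ?u x\<bar> \<le> (K + 2 * ?C / r) * \<bar>x - z\<bar>" if z: "z \<in> {0<..<1}" for z
  proof (cases "\<bar>x - z\<bar> \<le> r")
    case True
    then have "\<bar>x - z\<bar> \<le> x / 2" "\<bar>x - z\<bar> \<le> (1 - x) / 2" by (auto simp: r_def)
    moreover have "x - z \<le> \<bar>x - z\<bar>" "z - x \<le> \<bar>x - z\<bar>" by auto
    ultimately have "z \<in> {x/2..(x+1)/2}"
      unfolding atLeastAtMost_iff add_divide_distrib diff_divide_distrib
      by (smt (verit) field_sum_of_halves)
    then have "\<bar>?u z - ?u x\<bar> \<le> K * \<bar>x - z\<bar>"
      using lipschitz_onD[OF K(2), of z x] x by (simp add: dist_real_def abs_minus_commute)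
    moreover have "0 \<le> 2 * ?C / r * \<bar>x - z\<bar>" using r by simp
    ultimately show ?thesis by (simp add: distrib_right)
  next
    case False
    have "2 * ?C / r * r \<le> 2 * ?C / r * \<bar>x - z\<bar>"
      using False r by (intro mult_left_mono) auto
    moreover have "\<bar>?u z - ?u x\<bar> \<le> 2 * ?C"
      using u_le[of z] u_le[of x] x z by simp
    moreover have "0 \<le> K * \<bar>x - z\<bar>" using K by simp
    ultimately show ?thesis using r by (simp add: distrib_right)
  qed
  have cont: "continuous_on {0..1} H"
    by (rule continuous_on_subset[OF lipschitz_on_continuous_on[OF lip]]) simp
  have int: "(LINT y:{0<..<s}|lborel. H y) = integral {0..s} H" if "s \<in> {0<..<1}" for s
  proof -
    have "(LINT y:{0<..<s}|lborel. H y) = (LINT y:{0..s}|lborel. H y)"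
      by (rule set_integral_discrete_difference[of "{0, s}"]) auto
    also have "set_integrable lborel {0..s} H"
      unfolding set_integrable_def
      by (rule borel_integrable_compact) (use continuous_on_subset[OF cont, of "{0..s}"] that in auto)
    note set_borel_integral_eq_integral(2)[OF this]
    finally show ?thesis .
  qed
  have "((\<lambda>s. integral {0..s} H) has_real_derivative H x) (at x within {0..1})"
    by (rule integral_has_real_derivative[OF cont]) (use x in auto)
  then have "((\<lambda>s. integral {0..s} H) has_real_derivative H x) (at x)"
    using x by (simp only: at_within_Icc_at greaterThanLessThan_iff)
  from DERIV_cmult[OF DERIV_diff[OF DERIV_cmult[OF this] DERIV_const]]
  have "((\<lambda>s. ?c * (Beta \<alpha> \<alpha> * integral {0..s} H - ?A)) has_real_derivative ?c * (Beta \<alpha> \<alpha> * H x)) (at x)"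
    by (simp only: diff_zero)
  then have der: "((\<lambda>s. LINT z:{0<..<1}|lborel. ?u z * odd_kernel \<alpha> (s - z)) has_real_derivative ?c * (Beta \<alpha> \<alpha> * H x)) (at x)"
    by (rule has_field_derivative_transform_within_open[where S="{0<..<1}"])
       (use x in \<open>simp_all only: int green_solution_potential[OF \<alpha> H_measurable H_le_one] open_real_greaterThanLessThan\<close>)
  have "frac_lap_const \<alpha> * (?c * (Beta \<alpha> \<alpha> * H x)) / (2 * \<alpha>) =
      frac_lap_const \<alpha> * (?c * Beta \<alpha> \<alpha>) * H x / (2 * \<alpha>)"
    by (simp only: mult.assoc)
  also have "\<dots> = H x"
    unfolding frac_lap_const_Beta[OF \<alpha>] using \<alpha> by simp
  finally show ?thesis
    using has_frac_laplacian_if_potential[OF \<alpha> x borel_measurable_green_solution[OF \<alpha> H_measurable] lip_x der]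
    by simp
qed

end
end

section \<open>Existence and uniqueness for the original right-hand side\<close>

theorem theorem3:
  fixes \<alpha> a b :: real and h :: "real \<Rightarrow> real"
  assumes "0 < \<alpha>" and "\<alpha> < 1 / 2"
    and "1-lipschitz_on {0..1} h"
    and "a \<le> b" and "{a..b} \<subseteq> {0<..<1}"
    and "closure (support_on {0..1} h) = {a..b}"
  shows "dirichlet_solution \<alpha> h (green_solution \<alpha> h) \<and>
    (\<forall>g. dirichlet_solution \<alpha> h g \<longrightarrow> (\<forall>x\<in>{0..1}. g x = green_solution \<alpha> h x))"
proof -
  note \<alpha> = assms(1,2)
  have ab: "0 < a" "a \<le> b" "b < 1" using assms(4,5) by auto
  \<comment> \<open>Clamping the argument to [0,1] is 1-Lipschitz, so \<open>H\<close> is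
    1-Lipschitz on the whole line. It vanishes outside [a,b] because h is 0 at both end points,
    which lie outside its support.\<close>
  define H where "H y = h (max 0 (min 1 y))" for y
  have H_eq: "H y = h y" if "y \<in> {0..1}" for y
    using that by (simp add: H_def)
  have h0: "h y = 0" if "y \<in> {0..1}" "y \<notin> {a..b}" for y
    using that closure_subset[of "support_on {0..1} h"] assms(6) by (auto simp: support_on_def)
  have supp: "H y = 0" if "y \<notin> {a..b}" for y
    using that h0[of "max 0 (min 1 y)"] ab by (auto simp: H_def max_def min_def)
  have lip: "1-lipschitz_on UNIV H"
  proof (rule lipschitz_onI)
    fix y z :: real
    have "dist (H y) (H z) \<le> 1 * dist (max 0 (min 1 y)) (max 0 (min 1 z))"
      unfolding H_def by (rule lipschitz_onD[OF assms(3)]) auto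
    also have "\<dots> \<le> 1 * dist y z" by (auto simp: dist_real_def max_def min_def)
    finally show "dist (H y) (H z) \<le> 1 * dist y z" .
  qed simp
  have sol_eq: "green_solution \<alpha> h = green_solution \<alpha> H"
    by (intro ext) (auto simp: green_solution_def H_eq intro!: set_lebesgue_integral_cong)
  have sol: "dirichlet_solution \<alpha> h (green_solution \<alpha> h)"
    unfolding dirichlet_solution_def
  proof (intro conjI ballI)
    show "locally_contracting_on 0 1 (green_solution \<alpha> h)"
      unfolding locally_contracting_on_def sol_eq
    \<comment> \<open>Any positive \<delta> would do, since the solution is Lipschitz on every
      compact subinterval of ]0,1[.\<close>
    proof (rule exI[of _ 1], intro conjI allI impI)
      fix c d :: real assume "c \<le> d \<and> d - c < 1 \<and> {c..d} \<subseteq> {0<..<1}"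
      then show "\<exists>K>0. K-lipschitz_on {c..d} (green_solution \<alpha> H)"
        by (intro green_solution_Lipschitz[OF \<alpha> lip ab supp]) auto
    qed simp
    show "continuous_on {0..1} (green_solution \<alpha> h)"
      unfolding sol_eq by (rule continuous_on_green_solution[OF \<alpha> lip ab supp])
    show "has_frac_laplacian \<alpha> (green_solution \<alpha> h) x (h x)" if "x \<in> {0<..<1}" for x
      using has_frac_laplacian_green_solution[OF \<alpha> lip ab supp that] H_eq[of x] that by (simp add: sol_eq)
  qed (simp_all add: green_solution_def)
  have "g x = green_solution \<alpha> h x" if "dirichlet_solution \<alpha> h g" "x \<in> {0..1}" for g x
    by (rule antisym[OF dirichlet_solution_le[OF \<alpha> that(1) sol that(2)] dirichlet_solution_le[OF \<alpha> sol that]])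
  with sol show ?thesis by blast
qed

end
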